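(* Fix $0 < c < 1$. Let $G$ be a simple, undirected, connected graph on $n\ge 2$ vertices with minimum degree $\delta = cn$, adjacency eigenvalues $\lambda_1 \ge \dots \ge \lambda_n$ and normalized Perron eigenvector $\nu$. Let $\nu_{\min}=\min_i\nu_i$ and $\lambda = \max\{|\lambda_2|,|\lambda_n|\}$, and suppose $\lambda < \lambda_1cn\nu_{\min}^2$. Then the routing number of $G$ satisfies $$\operatorname{rt}(G) \le \frac{12n}{c(\lambda_1cn\nu_{\min}^2-\lambda)}.$$
   Context: Routing number: place one pebble on each vertex of $G=(V,E)$ and let $\pi$ be a permutation of $V$; the pebble starting on $v$ must be moved to $\pi(v)$. In each step one selects a matching of edges of $G$ and swaps the pebbles on the endpoints of every edge of the matching. $\operatorname{rt}(G,\pi)$ is the minimum number of steps needed to move all pebbles to their destinations, and $\operatorname{rt}(G)=\max_\pi \operatorname{rt}(G,\pi)$, the maximum over all permutations $\pi$ of $V$. The adjacency eigenvalues are the eigenvalues of the adjacency matrix $A$. The normalized Perron eigenvector $\nu$ is the unique eigenvector of $A$ for $\lambda_1$ with all entries positive and Euclidean norm $1$. *)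

theory Defs
  imports
    "Graph_Theory.Graph_Theory"
    "Jordan_Normal_Form.Char_Poly"
    "HOL-Combinatorics.Permutations"
begin

text \<open>
  A finite simple undirected graph is a symmetric, loop-free digraph without parallel arcs
  (locale \<open>pair_graph\<close>): the edge \<open>{u, v}\<close> is represented by the two arcs \<open>(u, v)\<close> and \<open>(v, u)\<close>.
  Hence the degree of a vertex is its out-degree.
\<close>

definition edges :: "'a pair_pre_digraph \<Rightarrow> 'a set set" where
  "edges G = {{u, v} | u v. (u, v) \<in> parcs G}"

definition min_degree :: "'a pair_pre_digraph \<Rightarrow> nat" where
  "min_degree G = Min (out_degree (with_proj G) ` pverts G)"

text \<open>The list \<open>vs\<close> fixes the order of the vertices, that is, of the rows and columns.\<close>

definition adjacency_matrix :: "'a pair_pre_digraph \<Rightarrow> 'a list \<Rightarrow> real mat" where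
  "adjacency_matrix G vs =
     mat (length vs) (length vs) (\<lambda>(i, j). if (vs ! i, vs ! j) \<in> parcs G then 1 else 0)"

text \<open>
  The \<open>k\<close>-th largest real eigenvalue, \<open>k \<ge> 1\<close>, counted with algebraic multiplicity. A real symmetric
  \<open>n \<times> n\<close> matrix has exactly \<open>n\<close> of them, so the index is in range for \<open>1 \<le> k \<le> n\<close>.
\<close>

definition eigval :: "real mat \<Rightarrow> nat \<Rightarrow> real" where
  "eigval A k = rev (sorted_list_of_multiset (proots (char_poly A))) ! (k - 1)"

definition normalized_perron_vector :: "real mat \<Rightarrow> real vec \<Rightarrow> bool" where
  "normalized_perron_vector A \<nu> \<longleftrightarrow>
     eigenvector A \<nu> (eigval A 1) \<and> (\<forall>i < dim_vec \<nu>. 0 < \<nu> $ i) \<and> sqrt (\<nu> \<bullet> \<nu>) = 1"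

definition min_entry :: "real vec \<Rightarrow> real" where
  "min_entry \<nu> = Min {\<nu> $ i | i. i < dim_vec \<nu>}"

definition is_matching :: "'a pair_pre_digraph \<Rightarrow> 'a set set \<Rightarrow> bool" where
  "is_matching G M \<longleftrightarrow> M \<subseteq> edges G \<and> pairwise disjnt M"

text \<open>New position of a pebble lying on \<open>v\<close> after the pebbles on the ends of each edge of \<open>M\<close> are
  swapped.\<close>

definition swap_along :: "'a set set \<Rightarrow> 'a \<Rightarrow> 'a" where
  "swap_along M v = (if \<exists>w. {v, w} \<in> M then THE w. {v, w} \<in> M else v)"

definition routes :: "'a pair_pre_digraph \<Rightarrow> ('a \<Rightarrow> 'a) \<Rightarrow> 'a set set list \<Rightarrow> bool" where
  "routes G \<pi> Ms \<longleftrightarrow>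
     (\<forall>M \<in> set Ms. is_matching G M) \<and> (\<forall>v \<in> pverts G. fold swap_along Ms v = \<pi> v)"

text \<open>
  In a connected graph every permutation of the vertices can be routed, so the minimum below is
  over a nonempty set.
\<close>

definition routing_number_of :: "'a pair_pre_digraph \<Rightarrow> ('a \<Rightarrow> 'a) \<Rightarrow> nat" where
  "routing_number_of G \<pi> = (LEAST k. \<exists>Ms. length Ms = k \<and> routes G \<pi> Ms)"

definition routing_number :: "'a pair_pre_digraph \<Rightarrow> nat" where
  "routing_number G = Max {routing_number_of G \<pi> | \<pi>. \<pi> permutes pverts G}"

end

theory Submission
  imports
    "HOL-Combinatorics.Cycles"
    "HOL-Analysis.Function_Topology"
    "HOL-Analysis.Convex"
    Defs
begin

text \<open>
  Write \<open>\<mu> = \<lambda>\<^sub>1 \<nu>\<^sub>m\<^sub>i\<^sub>n\<^sup>2\<close> and \<open>g = \<mu> c n - \<lambda>\<close>. By the expander mixing argument, two vertex sets of size \<open>s\<close>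
  with \<open>\<mu> s > \<lambda>\<close> are joined by an edge. Applied to neighbourhoods, this gives a path of length three
  between any two vertices that avoids up to \<open>4 (k - 1)\<close> prescribed vertices, where \<open>k = \<lceil>g / (4 \<mu>)\<rceil>\<close>.
  Hence up to \<open>k\<close> transpositions of non-adjacent vertices can be carried out simultaneously in three
  steps along disjoint paths.

  Every permutation is a product of two involutions. To save enough rounding error for \<open>c\<close> near 1, an
  involution \<open>\<sigma>\<close> is first treated in two steps on adjacent pairs and on pairs that span a 4-cycle; if the
  pairs \<open>{v, \<sigma> v}\<close> left over cover \<open>m\<close> vertices, then \<open>m \<le> min n (4 (1 - c) n)\<close>, and they are processed
  in \<open>\<lceil>m / (2 k)\<rceil>\<close> batches. Together with \<open>\<mu> \<le> 1\<close>, and \<open>\<mu> \<le> c\<close> if \<open>c \<ge> 1 / 2\<close>, this stays below \<open>6 n / (c g)\<close>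
  steps per involution.
\<close>

section \<open>Routing by involutions along edges\<close>

text \<open>Functional counterpart of \<open>routes\<close>: a matching acts as an involution that
  moves vertices only along arcs, and the empty matching acts as the identity.\<close>

inductive routable :: "'a rel \<Rightarrow> nat \<Rightarrow> ('a \<Rightarrow> 'a) \<Rightarrow> bool" for E where
  zero: "routable E 0 id"
| step: "routable E (Suc k) (f \<circ> \<pi>)"
  if "routable E k \<pi>" "\<And>v. f (f v) = v" "\<And>v. f v \<noteq> v \<Longrightarrow> (v, f v) \<in> E"

lemma routable_comp:
  assumes "routable E b \<sigma>" and \<pi>: "routable E a \<pi>"
  shows "routable E (a + b) (\<sigma> \<circ> \<pi>)"
  using assms(1)
proof induction
  case zero
  then show ?case using \<pi> by simp
next
  case (step k \<sigma> f)
  then have "routable E (Suc (a + k)) (f \<circ> (\<sigma> \<circ> \<pi>))" by (intro routable.step)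
  then show ?case by (simp only: comp_assoc add_Suc_right)
qed

lemma routable_single:
  assumes "\<And>v. f (f v) = v" "\<And>v. f v \<noteq> v \<Longrightarrow> (v, f v) \<in> E"
  shows "routable E 1 f"
  using routable.step[OF routable.zero, of f E] assms by simp

text \<open>Translates functional steps back into matchings: as \<open>f\<close> is an involution,
  two pairs \<open>{v, f v}\<close> are equal or disjoint.\<close>

lemma (in pair_graph) swap_along_involution:
  assumes inv: "\<And>v. f (f v) = v" and E: "\<And>v. f v \<noteq> v \<Longrightarrow> (v, f v) \<in> parcs G"
  shows "\<exists>M. is_matching G M \<and> swap_along M = f"
proof -
  define M where "M = {{v, f v} | v. f v \<noteq> v}"
  have M_iff: "{v, w} \<in> M \<longleftrightarrow> f v \<noteq> v \<and> w = f v" for v w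
    unfolding M_def by (auto simp: doubleton_eq_iff inv)
  have "M \<subseteq> edges G"
    unfolding M_def edges_def using E by blast
  moreover have "pairwise disjnt M"
    unfolding pairwise_def M_def disjnt_def by (auto simp: inv) (metis inv)+
  ultimately have "is_matching G M"
    by (simp add: is_matching_def)
  moreover have "swap_along M v = f v" for v
    by (auto simp: swap_along_def M_iff)
  ultimately show ?thesis by blast
qed

lemma (in pair_graph) routable_routes:
  assumes "routable (parcs G) k \<pi>"
  shows "\<exists>Ms. length Ms = k \<and> routes G \<pi> Ms"
  using assms
proof induction
  case zero
  show ?case by (simp add: routes_def)
next
  case (step k \<pi> f)
  then obtain Ms where "length Ms = k" "routes G \<pi> Ms" by blast
  moreover obtain M where "is_matching G M" "swap_along M = f"
    using swap_along_involution step by blast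
  ultimately have "length (Ms @ [M]) = Suc k \<and> routes G (f \<circ> \<pi>) (Ms @ [M])"
    by (auto simp: routes_def)
  then show ?case by blast
qed

lemma (in pair_graph) routing_number_of_le:
  assumes "routable (parcs G) k \<pi>"
  shows "routing_number_of G \<pi> \<le> k"
  unfolding routing_number_of_def using routable_routes[OF assms] by (rule Least_le)

text \<open>Writing \<open>x = \<pi>\<^sup>i r\<close> with \<open>r\<close> a fixed representative of the cycle of \<open>x\<close>, the reflection
  \<open>\<pi>\<^sup>i r \<mapsto> \<pi>\<^sup>-\<^sup>i r\<close> is an involution \<open>\<sigma>\<close>, and so is \<open>\<pi> \<circ> \<sigma>\<close>.\<close>

lemma permutes_involutions:
  assumes \<pi>: "\<pi> permutes V" and fin: "finite V"
  shows "\<exists>\<sigma> \<tau>. \<pi> = \<tau> \<circ> \<sigma> \<and> (\<forall>v. \<sigma> (\<sigma> v) = v) \<and> (\<forall>v. \<tau> (\<tau> v) = v)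
    \<and> \<sigma> permutes V \<and> \<tau> permutes V"
proof -
  define q where "q = inv_into UNIV \<pi>"
  have q\<pi>: "q (\<pi> x) = x" and \<pi>q: "\<pi> (q x) = x" for x
    unfolding q_def using \<pi> by (simp_all add: permutes_inverses)
  have qp: "(q ^^ i) ((\<pi> ^^ i) x) = x" for i x
    by (induction i arbitrary: x) (simp_all add: funpow_swap1 q\<pi>)
  have pq: "(\<pi> ^^ i) ((q ^^ i) x) = x" for i x
    by (induction i arbitrary: x) (simp_all add: funpow_swap1 \<pi>q)
  have "permutation \<pi>"
    using \<pi> fin permutation_permutes by blast
  then obtain N where N: "\<pi> ^^ N = id" "N > 0"
    using permutation_is_nilpotent by blast
  have mod: "(\<pi> ^^ (N * m)) x = x" for m x
    using N by (induction m) (simp_all add: funpow_add)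
  \<comment> \<open>Since \<open>\<pi>\<close> has finite order, inverse powers are forward powers.
    Hence reachability by forward powers is symmetric, and \<open>R\<close> below is the orbit
    relation.\<close>
  have q_pow: "(q ^^ i) x = (\<pi> ^^ (N * i - i)) x" for i x
  proof -
    have "i \<le> N * i" using N by simp
    then have "(\<pi> ^^ (N * i)) x = (\<pi> ^^ i) ((\<pi> ^^ (N * i - i)) x)"
      by (metis comp_apply funpow_add le_add_diff_inverse)
    then have "x = (\<pi> ^^ i) ((\<pi> ^^ (N * i - i)) x)" by (simp add: mod)
    then show ?thesis by (metis qp)
  qed
  define R where "R x y \<longleftrightarrow> (\<exists>i. y = (\<pi> ^^ i) x)" for x y
  have R_refl: "R x x" for x
    unfolding R_def by (rule exI[of _ 0]) simp
  have R_trans: "R x z" if "R x y" "R y z" for x y z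
    using that unfolding R_def by (metis comp_apply funpow_add)
  have R_sym: "R y x" if "R x y" for x y
    using that unfolding R_def by (metis qp q_pow)
  define r where "r x = (SOME y. R y x)" for x
  have Rr: "R (r x) x" for x
    unfolding r_def by (rule someI[of "\<lambda>y. R y x", OF R_refl])
  \<comment> \<open>Points of one orbit feed the same predicate to \<open>SOME\<close> and so share
    their representative.\<close>
  have r_eq: "r x = r y" if "R x y" for x y
  proof -
    have "(\<lambda>z. R z x) = (\<lambda>z. R z y)" using that R_trans R_sym by blast
    then show ?thesis by (simp add: r_def)
  qed
  define \<sigma> where "\<sigma> x = (q ^^ (LEAST i. x = (\<pi> ^^ i) (r x))) (r x)" for x
  \<comment> \<open>The exponent of \<open>x\<close> over \<open>r x\<close> is determined only
    modulo the cycle length. The reflected point is the same for every choice, so any convenient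
    exponent can be used below.\<close>
  have \<sigma>: "\<sigma> x = (q ^^ i) (r x)" if "x = (\<pi> ^^ i) (r x)" for x i
  proof -
    define j where "j = (LEAST i. x = (\<pi> ^^ i) (r x))"
    have j: "x = (\<pi> ^^ j) (r x)" unfolding j_def using that by (rule LeastI)
    have "(\<pi> ^^ (i + j)) ((q ^^ i) (r x)) = (\<pi> ^^ j) ((\<pi> ^^ i) ((q ^^ i) (r x)))"
      by (metis add.commute comp_apply funpow_add)
    also have "\<dots> = x" using j by (simp add: pq)
    also have "x = (\<pi> ^^ i) ((\<pi> ^^ j) ((q ^^ j) (r x)))" using that by (simp add: pq)
    also have "\<dots> = (\<pi> ^^ (i + j)) ((q ^^ j) (r x))" by (simp add: funpow_add)
    finally have "(q ^^ i) (r x) = (q ^^ j) (r x)" by (metis qp)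
    then show ?thesis by (simp add: \<sigma>_def j_def)
  qed
  have inv\<sigma>: "\<sigma> (\<sigma> x) = x" and inv\<tau>: "\<pi> (\<sigma> (\<pi> (\<sigma> x))) = x" for x
  proof -
    obtain i where i: "x = (\<pi> ^^ i) (r x)" using Rr[of x] unfolding R_def by blast
    define j where "j = N * i - i"
    have \<sigma>x: "\<sigma> x = (q ^^ i) (r x)" by (rule \<sigma>[OF i])
    also have sj: "\<dots> = (\<pi> ^^ j) (r x)" unfolding j_def by (rule q_pow)
    finally have \<sigma>j: "\<sigma> x = (\<pi> ^^ j) (r x)" .
    then have "R (r x) (\<sigma> x)" unfolding R_def by blast
    then have "R x (\<sigma> x)" using Rr R_sym R_trans by blast
    then have rs: "r (\<sigma> x) = r x" using r_eq by metis
    have "(q ^^ j) (r x) = (q ^^ j) ((\<pi> ^^ i) ((q ^^ i) (r x)))" by (simp add: pq)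
    also have "\<dots> = (q ^^ j) ((\<pi> ^^ i) ((\<pi> ^^ j) (r x)))" by (simp add: sj)
    also have "\<dots> = (q ^^ j) ((\<pi> ^^ j) ((\<pi> ^^ i) (r x)))" by (metis add.commute comp_apply funpow_add)
    also have "\<dots> = x" using i by (simp add: qp)
    finally have qj: "(q ^^ j) (r x) = x" .
    show "\<sigma> (\<sigma> x) = x"
      using \<sigma>[of "\<sigma> x" j] \<sigma>j rs qj by simp
    have R1: "R (\<sigma> x) (\<pi> (\<sigma> x))" unfolding R_def by (rule exI[of _ 1]) simp
    then have rp: "r (\<pi> (\<sigma> x)) = r x" using r_eq rs by metis
    have "\<pi> (\<sigma> x) = (\<pi> ^^ Suc j) (r x)" using \<sigma>j by simp
    then have "\<sigma> (\<pi> (\<sigma> x)) = (q ^^ Suc j) (r x)" using \<sigma>[of "\<pi> (\<sigma> x)" "Suc j"] rp by simp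
    also have "\<dots> = q x" using qj by simp
    finally show "\<pi> (\<sigma> (\<pi> (\<sigma> x))) = x" by (simp add: \<pi>q)
  qed
  have fixed: "\<sigma> x = x" if "x \<notin> V" for x
  proof -
    have "(\<pi> ^^ i) x = x" for i
      using that \<pi> by (induction i) (simp_all add: permutes_not_in)
    moreover have "R x (r x)" using Rr R_sym by blast
    ultimately have "r x = x" unfolding R_def by auto
    then show ?thesis using \<sigma>[of x 0] by simp
  qed
  have \<sigma>V: "\<sigma> permutes V"
    unfolding permutes_def using fixed inv\<sigma> by metis
  then have "(\<pi> \<circ> \<sigma>) permutes V" using \<pi> by (rule permutes_compose)
  moreover have "\<pi> = (\<pi> \<circ> \<sigma>) \<circ> \<sigma>" by (simp add: fun_eq_iff inv\<sigma>)
  ultimately show ?thesis using inv\<sigma> inv\<tau> \<sigma>V by (metis comp_apply)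
qed

section \<open>Exchanging pairs along disjoint paths, batch by batch\<close>

definition restr :: "('a \<Rightarrow> 'a) \<Rightarrow> 'a set \<Rightarrow> 'a \<Rightarrow> 'a" where
  "restr f X = (\<lambda>v. if v \<in> X then f v else v)"

lemma restr_Un:
  assumes "X \<inter> Y = {}" "f ` X \<subseteq> X"
  shows "restr f (X \<union> Y) = restr f Y \<circ> restr f X"
  using assms by (fastforce simp: restr_def fun_eq_iff)

text \<open>The two ends \<open>u, v\<close> of a path \<open>u, f u, f v, v\<close> are exchanged by conjugating the swap of
  its middle edge with the swaps of its outer edges.\<close>

lemma (in pair_graph) route_batch:
  assumes inv: "\<And>v. \<sigma> (\<sigma> v) = v" and XV: "X \<subseteq> pverts G" and X: "\<sigma> ` X \<subseteq> X"
    and nonadj: "\<And>x. x \<in> X \<Longrightarrow> \<sigma> x \<noteq> x \<and> (x, \<sigma> x) \<notin> parcs G"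
    and card: "card X \<le> 2 * k"
    and path: "\<And>u v W. u \<in> pverts G \<Longrightarrow> v \<in> pverts G \<Longrightarrow> finite W \<Longrightarrow> card W \<le> 4 * (k - 1) \<Longrightarrow>
      \<exists>x y. x \<notin> W \<and> y \<notin> W \<and> (u, x) \<in> parcs G \<and> (x, y) \<in> parcs G \<and> (y, v) \<in> parcs G"
  shows "routable (parcs G) 3 (restr \<sigma> X)"
proof -
  have finX: "finite X" using XV pair_finite_verts finite_subset by blast
  \<comment> \<open>\<open>f y\<close> is to be the inner vertex next to \<open>y\<close> on the
    path from \<open>y\<close> to \<open>\<sigma> y\<close>. Injectivity of \<open>f\<close> and
    avoidance of all of \<open>X\<close> keep the paths disjoint; the induction adds one pair
    \<open>{u, \<sigma> u}\<close> at a time.\<close>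
  have "\<exists>f. inj_on f Y \<and> f ` Y \<inter> X = {} \<and> (\<forall>y\<in>Y. (y, f y) \<in> parcs G \<and> (f y, f (\<sigma> y)) \<in> parcs G)"
    if "Y \<subseteq> X" "\<sigma> ` Y \<subseteq> Y" for Y
    using that
  proof (induction "card Y" arbitrary: Y rule: less_induct)
    case less
    show ?case
    proof (cases "Y = {}")
      case False
      then obtain u where u: "u \<in> Y" by blast
      define v where "v = \<sigma> u"
      define Z where "Z = Y - {u, v}"
      have v: "v \<in> Y" "v \<noteq> u" "\<sigma> v = u" "(u, v) \<notin> parcs G" "(v, u) \<notin> parcs G"
        using u less.prems nonadj[of u] nonadj[of v] inv by (auto simp: v_def)
      have finY: "finite Y" using less.prems finX finite_subset by blast
      have cZ: "card Z + 2 = card Y"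
        unfolding Z_def using u v finY card_mono[of Y "{u, v}"] by (subst card_Diff_subset) auto
      have Zcl: "\<sigma> ` Z \<subseteq> Z"
        using less.prems inv unfolding Z_def v_def by auto metis+
      obtain f where f: "inj_on f Z" "f ` Z \<inter> X = {}"
        "\<And>y. y \<in> Z \<Longrightarrow> (y, f y) \<in> parcs G \<and> (f y, f (\<sigma> y)) \<in> parcs G"
        using less.hyps[of Z] cZ less.prems(1) Zcl Z_def by force
      \<comment> \<open>The new path must avoid the other endpoints and the inner vertices already
        in use. Each kind numbers at most \<open>2 * k - 2\<close>, which explains the bound
        \<open>4 * (k - 1)\<close>.\<close>
      define W where "W = (X - {u, v}) \<union> f ` Z"
      have finW: "finite W" using finX finY by (auto simp: W_def Z_def)
      have "card W \<le> card (X - {u, v}) + card (f ` Z)"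
        unfolding W_def by (rule card_Un_le)
      also have "card (X - {u, v}) = card X - 2"
        using u v less.prems finX by (subst card_Diff_subset) auto
      also have "card (f ` Z) \<le> card Z" using finY by (simp add: card_image_le Z_def)
      also have "card Z \<le> card X - 2" using cZ card_mono[OF finX less.prems(1)] by linarith
      finally have "card W \<le> 4 * (k - 1)" using card by linarith
      then obtain x y where xy: "x \<notin> W" "y \<notin> W" "(u, x) \<in> parcs G" "(x, y) \<in> parcs G" "(y, v) \<in> parcs G"
        using path[of u v W] u v XV less.prems(1) finW by blast
      \<comment> \<open>The ends \<open>u\<close> and \<open>v\<close> do not belong to
        \<open>W\<close>. Loop-freeness and the non-adjacency of \<open>u\<close> and
        \<open>v\<close> keep the inner vertices away from them.\<close>
      have neq: "x \<noteq> u" "x \<noteq> v" "y \<noteq> u" "y \<noteq> v" "x \<noteq> y"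
        using xy v no_loops' arcs_symmetric by blast+
      then have notX: "x \<notin> X" "y \<notin> X" "x \<notin> f ` Z" "y \<notin> f ` Z"
        using xy by (auto simp: W_def)
      define h where "h = f(u := x, v := y)"
      have hZ: "h z = f z" if "z \<in> Z" for z using that by (auto simp: h_def Z_def)
      have huv: "h u = x" "h v = y" using v by (auto simp: h_def)
      have Y: "Y = insert u (insert v Z)" using u v by (auto simp: Z_def)
      have "inj_on h Z" using f(1) hZ by (simp add: inj_on_def)
      moreover have h_image: "h ` Z = f ` Z" using hZ by (rule image_cong[OF refl])
      ultimately have "inj_on h Y"
        unfolding Y inj_on_insert using notX neq huv by auto
      moreover have "h ` Y \<inter> X = {}"
        unfolding Y image_insert huv h_image using f(2) notX by auto
      moreover have "(z, h z) \<in> parcs G \<and> (h z, h (\<sigma> z)) \<in> parcs G" if z: "z \<in> Y" for z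
      proof -
        consider "z = u" | "z = v" | "z \<in> Z" using z Y by blast
        then show ?thesis
        proof cases
          case 3
          then show ?thesis using f(3) hZ Zcl by auto
        qed (use huv xy v arcs_symmetric v_def in auto)
      qed
      ultimately show ?thesis by blast
    qed auto
  qed
  from this[OF order_refl X] obtain f where f: "inj_on f X" "f ` X \<inter> X = {}"
    "\<And>y. y \<in> X \<Longrightarrow> (y, f y) \<in> parcs G" "\<And>y. y \<in> X \<Longrightarrow> (f y, f (\<sigma> y)) \<in> parcs G"
    by blast
  define g where "g = inv_into X f"
  have g: "g (f x) = x" if "x \<in> X" for x using that f(1) by (simp add: g_def)
  define a where "a = (\<lambda>v. if v \<in> X then f v else if v \<in> f ` X then g v else v)"
  define b where "b = (\<lambda>v. if v \<in> f ` X then f (\<sigma> (g v)) else v)"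
  have aX: "a x = f x" "a (f x) = x" "b (f x) = f (\<sigma> x)" "b x = x" if "x \<in> X" for x
    using that f(2) g by (auto simp: a_def b_def)
  have a0: "a v = v" "b v = v" if "v \<notin> X" "v \<notin> f ` X" for v
    using that by (auto simp: a_def b_def)
  have cases: "v \<in> X \<or> (\<exists>x\<in>X. v = f x) \<or> (v \<notin> X \<and> v \<notin> f ` X)" for v by blast
  have \<sigma>X: "\<sigma> x \<in> X" if "x \<in> X" for x using that X by blast
  have a: "a (a v) = v" "a v \<noteq> v \<Longrightarrow> (v, a v) \<in> parcs G" for v
    using cases[of v] aX a0 f(3) arcs_symmetric by metis+
  have b: "b (b v) = v" "b v \<noteq> v \<Longrightarrow> (v, b v) \<in> parcs G" for v
    using cases[of v] aX a0 f(4) inv \<sigma>X by metis+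
  have "(a \<circ> (b \<circ> a)) v = restr \<sigma> X v" for v
  proof -
    consider "v \<in> X" | x where "x \<in> X" "v = f x" | "v \<notin> X" "v \<notin> f ` X" by blast
    then show ?thesis
    proof cases
      case 2
      then have "v \<notin> X" using f(2) by blast
      then show ?thesis using 2 by (simp add: restr_def aX)
    qed (simp_all add: restr_def aX a0 \<sigma>X)
  qed
  then have "a \<circ> (b \<circ> a) = restr \<sigma> X" by blast
  moreover have "routable (parcs G) (1 + 1 + 1) (a \<circ> (b \<circ> a))"
    using routable_comp[OF routable_single[of a] routable_comp[OF routable_single[of b] routable_single[of a]]]
      a b by blast
  ultimately show ?thesis by (simp add: numeral_3_eq_3)
qed

text \<open>Grows the subset by one pair \<open>{u, \<sigma> u}\<close> at a time; it serves to cut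
  off a batch of exactly \<open>k\<close> pairs.\<close>

lemma closed_subset_card:
  assumes "finite X" "\<And>v. \<sigma> (\<sigma> v) = v" "\<sigma> ` X \<subseteq> X" "\<And>x. x \<in> X \<Longrightarrow> \<sigma> x \<noteq> x" "2 * j \<le> card X"
  shows "\<exists>Y\<subseteq>X. \<sigma> ` Y \<subseteq> Y \<and> card Y = 2 * j"
  using assms(5)
proof (induction j)
  case (Suc j)
  then obtain Y where Y: "Y \<subseteq> X" "\<sigma> ` Y \<subseteq> Y" "card Y = 2 * j" by auto
  have "Y \<noteq> X" using Y Suc.prems by auto
  then obtain u where u: "u \<in> X" "u \<notin> Y" using Y by blast
  have fY: "finite Y" using Y assms(1) finite_subset by blast
  have su: "\<sigma> u \<notin> Y" using u Y(2) assms(2) by (metis image_subset_iff)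
  have "card (insert u (insert (\<sigma> u) Y)) = 2 * Suc j"
    using u su fY assms(4)[of u] Y(3) by simp
  moreover have "\<sigma> ` insert u (insert (\<sigma> u) Y) \<subseteq> insert u (insert (\<sigma> u) Y)"
    using Y(2) assms(2) by auto
  moreover have "insert u (insert (\<sigma> u) Y) \<subseteq> X" using Y(1) u assms(3) by auto
  ultimately show ?case by blast
qed (rule exI[of _ "{}"], simp)

text \<open>Each round of three steps removes a full batch of \<open>k\<close> pairs, or everything
  that is left if at most \<open>2 * k\<close> vertices remain.\<close>

lemma (in pair_graph) route_batches:
  assumes inv: "\<And>v. \<sigma> (\<sigma> v) = v"
    and path: "\<And>u v W. u \<in> pverts G \<Longrightarrow> v \<in> pverts G \<Longrightarrow> finite W \<Longrightarrow> card W \<le> 4 * (k - 1) \<Longrightarrow>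
      \<exists>x y. x \<notin> W \<and> y \<notin> W \<and> (u, x) \<in> parcs G \<and> (x, y) \<in> parcs G \<and> (y, v) \<in> parcs G"
    and "X \<subseteq> pverts G" "\<sigma> ` X \<subseteq> X" "\<And>x. x \<in> X \<Longrightarrow> \<sigma> x \<noteq> x \<and> (x, \<sigma> x) \<notin> parcs G"
    and "card X \<le> t * (2 * k)"
  shows "routable (parcs G) (3 * t) (restr \<sigma> X)"
  using assms(3-)
proof (induction t arbitrary: X)
  case 0
  then have "X = {}" using pair_finite_verts finite_subset by fastforce
  then have "restr \<sigma> X = id" by (auto simp: restr_def)
  then show ?case by (simp only: mult_0_right routable.zero)
next
  case (Suc t)
  have fin: "finite X" using Suc.prems(1) pair_finite_verts finite_subset by blast
  have "\<exists>Y\<subseteq>X. \<sigma> ` Y \<subseteq> Y \<and> card Y \<le> 2 * k \<and> card X - card Y \<le> t * (2 * k)"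
  proof (cases "card X \<le> 2 * k")
    case True
    then show ?thesis using Suc.prems(2) by (intro exI[of _ X]) simp
  next
    case False
    then obtain Y where "Y \<subseteq> X" "\<sigma> ` Y \<subseteq> Y" "card Y = 2 * k"
      using Suc.prems(3) closed_subset_card[OF fin inv Suc.prems(2), of k] by (metis nle_le)
    moreover from this have "card X - card Y \<le> t * (2 * k)"
      using Suc.prems(4) unfolding mult_Suc by linarith
    ultimately show ?thesis by (intro exI[of _ Y]) simp
  qed
  then obtain Y where Y: "Y \<subseteq> X" "\<sigma> ` Y \<subseteq> Y" "card Y \<le> 2 * k" "card X - card Y \<le> t * (2 * k)"
    by blast
  have cl: "\<sigma> ` (X - Y) \<subseteq> X - Y"
    using Y(2) Suc.prems(2) inv by (auto simp: image_subset_iff)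
  have cd: "card (X - Y) \<le> t * (2 * k)"
    using Y(1,4) fin by (simp add: card_Diff_subset finite_subset)
  have "routable (parcs G) (3 * t) (restr \<sigma> (X - Y))"
    using Suc.prems(1,3) cl cd by (intro Suc.IH) auto
  moreover have "routable (parcs G) 3 (restr \<sigma> Y)"
    using Y Suc.prems(1,3) by (intro route_batch[OF inv _ _ _ _ path, of Y]) auto
  moreover have "restr \<sigma> X = restr \<sigma> (X - Y) \<circ> restr \<sigma> Y"
    using restr_Un[of Y "X - Y" \<sigma>] Y by (simp add: Un_absorb1)
  ultimately show ?case
    using routable_comp[of "parcs G" "3 * t" "restr \<sigma> (X - Y)" 3 "restr \<sigma> Y"]
    by (simp only: mult_Suc_right)
qed

section \<open>Spectral bounds\<close>

locale symmetric_form =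
  fixes n :: nat and a :: "nat \<Rightarrow> nat \<Rightarrow> real"
  assumes sym: "i < n \<Longrightarrow> j < n \<Longrightarrow> a i j = a j i"
begin

definition ip :: "(nat \<Rightarrow> real) \<Rightarrow> (nat \<Rightarrow> real) \<Rightarrow> real" where
  "ip x y = (\<Sum>i<n. x i * y i)"

definition op :: "(nat \<Rightarrow> real) \<Rightarrow> nat \<Rightarrow> real" where
  "op x i = (\<Sum>j<n. a i j * x j)"

lemma ip_commute: "ip x y = ip y x"
  by (simp add: ip_def mult.commute)

lemma ip_add: "ip (\<lambda>i. x i + t * y i) z = ip x z + t * ip y z"
  by (simp add: ip_def sum.distrib sum_distrib_left algebra_simps)

lemma ip_add_right: "ip z (\<lambda>i. x i + t * y i) = ip z x + t * ip z y"
  using ip_add[of x t y z] by (simp add: ip_commute)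

lemma op_add: "op (\<lambda>i. x i + t * y i) = (\<lambda>i. op x i + t * op y i)"
  by (rule ext) (simp add: op_def sum.distrib sum_distrib_left algebra_simps)

lemma ip_op: "ip x (op y) = ip y (op x)"
proof -
  have "ip x (op y) = (\<Sum>i<n. \<Sum>j<n. a i j * x i * y j)"
    by (simp add: ip_def op_def sum_distrib_left algebra_simps)
  also have "\<dots> = (\<Sum>j<n. \<Sum>i<n. a i j * x i * y j)" by (rule sum.swap)
  also have "\<dots> = (\<Sum>j<n. \<Sum>i<n. a j i * x i * y j)"
    by (intro sum.cong refl) (simp add: sym)
  also have "\<dots> = ip y (op x)"
    by (simp add: ip_def op_def sum_distrib_left algebra_simps)
  finally show ?thesis .
qed

lemma ip_self: "0 \<le> ip x x"
  by (simp add: ip_def sum_nonneg)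

lemma ip_self_eq_0: "ip x x = 0 \<longleftrightarrow> (\<forall>i<n. x i = 0)"
  by (auto simp: ip_def sum_nonneg_eq_0_iff)

lemma form_add: "ip (\<lambda>i. x i + t * y i) (op (\<lambda>i. x i + t * y i))
    = ip x (op x) + 2 * t * ip y (op x) + t\<^sup>2 * ip y (op y)"
  by (simp add: op_add ip_add ip_add_right ip_op[of x y] power2_eq_square algebra_simps)

lemma self_add: "ip (\<lambda>i. x i + t * y i) (\<lambda>i. x i + t * y i)
    = ip x x + 2 * t * ip y x + t\<^sup>2 * ip y y"
  by (simp add: ip_add ip_add_right ip_commute[of x y] power2_eq_square algebra_simps)

text \<open>Vectors are functions on \<open>nat\<close> so that compactness comes from the product
  topology; entries from \<open>n\<close> on are pinned to 0 because free coordinates would destroy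
  it.\<close>

definition unit_sphere_perp :: "(nat \<Rightarrow> real) \<Rightarrow> (nat \<Rightarrow> real) set" where
  "unit_sphere_perp p = {x. (\<forall>i. n \<le> i \<longrightarrow> x i = 0) \<and> ip x x = 1 \<and> ip x p = 0}"

lemma compact_unit_sphere_perp: "compact (unit_sphere_perp p)"
proof -
  define C :: "(nat \<Rightarrow> real) set" where "C = PiE UNIV (\<lambda>i. if i < n then {-1..1} else {0})"
  have "compactin (product_topology (\<lambda>_. euclidean) UNIV) C"
    unfolding C_def compactin_PiE by simp
  then have "compact C"
    by (simp add: euclidean_product_topology)
  moreover have "closed {x. ip x x = 1 \<and> ip x p = 0}"
    unfolding ip_def by (intro closed_Collect_conj closed_Collect_eq continuous_intros
      continuous_on_product_coordinates)
  moreover have "unit_sphere_perp p = C \<inter> {x. ip x x = 1 \<and> ip x p = 0}"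
  proof -
    have "x i \<in> {-1..1}" if "ip x x = 1" "i < n" for x i
    proof -
      have "x i * x i \<le> ip x x"
        unfolding ip_def using that by (intro member_le_sum) auto
      then have "\<bar>x i\<bar> \<le> 1"
        using that by (simp add: abs_le_square_iff[of _ 1, simplified] power2_eq_square)
      then show ?thesis by auto
    qed
    then show ?thesis
      unfolding unit_sphere_perp_def C_def by (auto simp: PiE_iff split: if_splits)
  qed
  ultimately show ?thesis by (simp add: compact_Int_closed)
qed

lemma continuous_form: "continuous_on X (\<lambda>x. ip x (op x))"
  unfolding ip_def op_def
  by (intro continuous_intros continuous_on_subset[OF continuous_on_product_coordinates] subset_UNIV)

text \<open>The vector \<open>(p 1, - p 0, 0, ...)\<close> is orthogonal to \<open>p\<close>, and
  \<open>p 0 \<noteq> 0\<close> makes it nonzero, so it can be normalized.\<close>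

lemma unit_sphere_perp_nonempty:
  assumes "2 \<le> n" "p 0 \<noteq> 0"
  shows "unit_sphere_perp p \<noteq> {}"
proof -
  define s where "s = sqrt ((p 0)\<^sup>2 + (p 1)\<^sup>2)"
  have s: "s\<^sup>2 = (p 0)\<^sup>2 + (p 1)\<^sup>2" "s \<noteq> 0"
    using assms by (simp_all add: s_def)
  define x where "x i = (if i = 0 then p 1 / s else if i = 1 then - p 0 / s else 0)" for i :: nat
  obtain m where m: "n = Suc (Suc m)"
    using assms by (metis add_2_eq_Suc le_Suc_ex)
  have split: "(\<Sum>i<n. x i * y i) = x 0 * y 0 + x 1 * y 1" for y
    unfolding m lessThan_Suc_eq_insert_0 image_image
    by (subst sum.insert; simp add: image_iff sum.reindex)+ (simp add: x_def)
  have "ip x x = ((p 1)\<^sup>2 + (p 0)\<^sup>2) / s\<^sup>2"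
    unfolding ip_def split by (simp add: x_def power2_eq_square add_divide_distrib)
  then have "ip x x = s\<^sup>2 / s\<^sup>2" by (simp only: s(1) add.commute)
  then have "ip x x = 1" using s(2) by simp
  moreover have "ip x p = 0"
    unfolding ip_def split by (simp add: x_def)
  moreover have "\<forall>i. n \<le> i \<longrightarrow> x i = 0"
    using assms by (auto simp: x_def)
  ultimately show ?thesis unfolding unit_sphere_perp_def by blast
qed

text \<open>The witness \<open>w\<close> maximises the absolute value of the form on the unit sphere of the orthogonal
  complement of \<open>p\<close>; it is an eigenvector because the form minus \<open>m ip x x\<close> has a constant sign
  there and vanishes at \<open>w\<close>, so that its first-order term at \<open>w\<close> is zero.\<close>

lemma extremal_eigenvector:
  assumes n: "2 \<le> n" and p: "p 0 \<noteq> 0" and eig: "\<And>i. i < n \<Longrightarrow> op p i = l * p i"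
  obtains w m where "ip w w = 1" "ip w p = 0" "\<And>i. i < n \<Longrightarrow> op w i = m * w i"
    "\<And>x. ip x p = 0 \<Longrightarrow> \<bar>ip x (op x)\<bar> \<le> \<bar>m\<bar> * ip x x"
proof -
  have "\<exists>w \<in> unit_sphere_perp p. \<forall>x \<in> unit_sphere_perp p. \<bar>ip x (op x)\<bar> \<le> \<bar>ip w (op w)\<bar>"
    by (intro continuous_attains_sup compact_unit_sphere_perp unit_sphere_perp_nonempty n p
        continuous_intros continuous_form)
  then obtain w where w: "ip w w = 1" "ip w p = 0"
    and w_max: "\<And>x. x \<in> unit_sphere_perp p \<Longrightarrow> \<bar>ip x (op x)\<bar> \<le> \<bar>ip w (op w)\<bar>"
    unfolding unit_sphere_perp_def by blast
  define m where "m = ip w (op w)"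
  have bound: "\<bar>ip x (op x)\<bar> \<le> \<bar>m\<bar> * ip x x" if x: "ip x p = 0" for x
  proof (cases "ip x x = 0")
    case True
    then have "\<forall>i<n. x i = 0" by (simp add: ip_self_eq_0)
    then have "ip x (op x) = 0" by (simp add: ip_def)
    then show ?thesis using True by simp
  next
    case False
    define s where "s = sqrt (ip x x)"
    have s: "s > 0" "s * s = ip x x"
      using False ip_self[of x] by (simp_all add: s_def)
    define y where "y i = (if i < n then x i / s else 0)" for i
    have ipy: "ip y z = ip x z / s" for z
      by (simp add: ip_def y_def sum_divide_distrib)
    have opy: "op y = (\<lambda>i. op x i / s)"
      by (rule ext) (simp add: op_def y_def sum_divide_distrib)
    have "ip y y = 1"
      using s by (simp add: ipy) (simp add: ip_commute[of x y] ipy flip: s(2))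
    then have "y \<in> unit_sphere_perp p"
      using x by (simp add: unit_sphere_perp_def ipy) (simp add: y_def)
    moreover have "ip y (op y) = ip x (op x) / (s * s)"
      unfolding ipy opy by (simp add: ip_def sum_divide_distrib)
    ultimately have "\<bar>ip x (op x)\<bar> / ip x x \<le> \<bar>m\<bar>"
      using w_max[of y] s ip_self[of x] by (simp add: m_def abs_divide)
    then show ?thesis using False ip_self[of x] by (simp add: divide_le_eq)
  qed
  \<comment> \<open>The residual \<open>r\<close> is orthogonal to \<open>p\<close>, so
    \<open>w + t r\<close> stays in the complement. Once the first-order term in direction
    \<open>r\<close> vanishes, \<open>ip r r = 0\<close> follows and \<open>w\<close> is an
    eigenvector.\<close>
  define r where "r i = op w i + (- m) * w i" for i
  have op_p: "ip z (op p) = l * ip z p" for z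
    by (simp add: ip_def eig sum_distrib_left algebra_simps)
  have rp: "ip r p = 0"
    unfolding r_def ip_add using op_p[of w] ip_op[of w p] w(2) by (simp add: ip_commute)
  have "ip r (op w) = m * ip r w"
  proof (rule ccontr)
    define e where "e = ip r (op w) - m * ip r w"
    define d where "d = ip r (op r) - m * ip r r"
    assume "ip r (op w) \<noteq> m * ip r w"
    then have e: "e \<noteq> 0" by (simp add: e_def)
    \<comment> \<open>Along \<open>w + t r\<close> the form minus \<open>m ip x x\<close> equals
      \<open>2 t e + t\<^sup>2 d\<close>. The factor \<open>sgn m\<close> treats maximum and minimum
      alike; for \<open>m = 0\<close> the form vanishes on the whole complement, which gives an
      equation.\<close>
    have sgn: "0 \<le> 2 * t * (sgn m * - e) + t\<^sup>2 * (sgn m * - d)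
        \<and> (m = 0 \<longrightarrow> 2 * t * e + t\<^sup>2 * d = 0)" for t
    proof -
      define x where "x = (\<lambda>i. w i + t * r i)"
      have "ip x p = 0" by (simp add: x_def ip_add w(2) rp)
      then have b: "\<bar>ip x (op x)\<bar> \<le> \<bar>m\<bar> * ip x x" by (rule bound)
      have "ip x (op x) - m * ip x x = 2 * t * e + t\<^sup>2 * d"
        unfolding x_def form_add self_add e_def d_def using w(1)
        by (simp add: m_def algebra_simps)
      moreover have "sgn m * (ip x (op x) - m * ip x x) \<le> 0"
        using b ip_self[of x] by (cases m "0::real" rule: linorder_cases) auto
      ultimately show ?thesis using b by (auto simp: algebra_simps)
    qed
    show False
    proof (cases "m = 0")
      case True
      then have "2 * e + d = 0" "- 2 * e + d = 0" using sgn[of 1] sgn[of "-1"] by simp_all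
      then show False using e by simp
    next
      case False
      define e' d' where "e' = sgn m * - e" and "d' = sgn m * - d"
      have e': "e' \<noteq> 0" using e False by (simp add: e'_def sgn_0_0)
      have all: "0 \<le> 2 * t * e' + t\<^sup>2 * d'" for t
        using sgn[of t] by (simp add: e'_def d'_def)
      \<comment> \<open>A short step against the sign of \<open>e'\<close>: its length makes the
        linear term outweigh the quadratic one, and the summand 1 keeps the denominator
        positive.\<close>
      define t where "t = - e' / (\<bar>d'\<bar> + 1)"
      have "t * (\<bar>d'\<bar> + 1) = - e'" by (simp add: t_def add_nonneg_eq_0_iff)
      then have "t\<^sup>2 * (\<bar>d'\<bar> + 1) = t * - e'"
        by (metis mult.assoc power2_eq_square)
      then have "2 * t * e' + t\<^sup>2 * (\<bar>d'\<bar> + 1) = t * e'" by simp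
      moreover have "t * e' < 0"
        using e' by (simp add: t_def divide_less_0_iff mult_less_0_iff zero_less_mult_iff)
          (auto simp: neq_iff mult_pos_pos mult_neg_neg intro!: divide_pos_pos add_nonneg_pos)
      moreover have "t\<^sup>2 * d' \<le> t\<^sup>2 * (\<bar>d'\<bar> + 1)" by (intro mult_left_mono) auto
      ultimately show False using all[of t] by linarith
    qed
  qed
  then have "ip r r = 0"
    unfolding r_def[abs_def] ip_add_right by (simp add: r_def[abs_def])
  then have "\<And>i. i < n \<Longrightarrow> op w i = m * w i"
    by (simp add: ip_self_eq_0 r_def)
  then show thesis using that w bound by blast
qed

text \<open>The forms at \<open>x + y\<close> and \<open>x - y\<close> differ by
  \<open>4 * ip x (op y)\<close>, while by the parallelogram law their squared norms add up to
  \<open>2 * (ip x x + ip y y)\<close>.\<close>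

lemma polarization_bound:
  assumes "\<And>x. ip x p = 0 \<Longrightarrow> \<bar>ip x (op x)\<bar> \<le> c * ip x x"
    and "ip x p = 0" "ip y p = 0"
  shows "2 * \<bar>ip x (op y)\<bar> \<le> c * (ip x x + ip y y)"
proof -
  have "ip (\<lambda>i. x i + 1 * y i) p = 0" "ip (\<lambda>i. x i + (-1) * y i) p = 0"
    unfolding ip_add using assms by simp_all
  from this[THEN assms(1)] show ?thesis
    unfolding form_add self_add ip_op[of y x] by (auto simp: abs_le_iff algebra_simps)
qed

text \<open>A second eigenvector can be shifted along the positive one until it is nonnegative with a zero
  entry; then all its entries vanish.\<close>

lemma positive_eigenvector_unique:
  assumes pos: "\<And>i. i < n \<Longrightarrow> 0 < p i" and eig: "\<And>i. i < n \<Longrightarrow> op p i = l * p i"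
    and nonneg: "\<And>i j. i < n \<Longrightarrow> j < n \<Longrightarrow> 0 \<le> a i j"
    and irred: "\<And>Z. Z \<subset> {..<n} \<Longrightarrow> Z \<noteq> {} \<Longrightarrow> \<exists>i\<in>Z. \<exists>j\<in>{..<n} - Z. a i j \<noteq> 0"
    and w: "ip w p = 0" "\<And>i. i < n \<Longrightarrow> op w i = l * w i"
  shows "ip w w = 0"
proof (cases "n = 0")
  case False
  \<comment> \<open>The largest \<open>t\<close> for which \<open>w - t p\<close> is still
    nonnegative; the minimizing index gives the zero entry.\<close>
  define t where "t = Min ((\<lambda>i. w i / p i) ` {..<n})"
  have t_le: "t \<le> w i / p i" if "i < n" for i
    unfolding t_def using that by (intro Min_le) auto
  have "t \<in> (\<lambda>i. w i / p i) ` {..<n}"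
    unfolding t_def using False by (intro Min_in) auto
  then obtain i0 where i0: "i0 < n" "t = w i0 / p i0" by auto
  define u where "u = (\<lambda>i. w i + (- t) * p i)"
  have u_nonneg: "0 \<le> u i" if "i < n" for i
    using t_le[OF that] pos[OF that] by (simp add: u_def field_simps)
  have op_u: "op u i = l * u i" if "i < n" for i
    unfolding u_def op_add using that eig w(2) by (simp add: algebra_simps)
  define Z where "Z = {i. i < n \<and> u i = 0}"
  have "i0 \<in> Z" using i0 pos[of i0] by (simp add: Z_def u_def)
  \<comment> \<open>At a zero of \<open>u\<close> the eigenvalue equation is a vanishing sum of
    nonnegative terms. Thus no nonzero entry leads out of \<open>Z\<close>, and irreducibility makes
    \<open>Z\<close> everything.\<close>
  moreover have "a i j = 0" if "i \<in> Z" "j \<in> {..<n} - Z" for i j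
  proof -
    have "(\<Sum>j<n. a i j * u j) = 0"
      using op_u[of i] that by (simp add: op_def Z_def)
    then have "a i j * u j = 0"
      using that nonneg u_nonneg by (subst (asm) sum_nonneg_eq_0_iff) (auto simp: Z_def)
    then show ?thesis using that by (auto simp: Z_def)
  qed
  ultimately have "Z = {..<n}"
    using irred[of Z] by (auto simp: Z_def)
  then have wt: "w i = t * p i" if "i < n" for i
    using that by (auto simp: Z_def u_def)
  then have "t * ip p p = 0"
    using w(1) by (simp add: ip_def sum_distrib_left algebra_simps)
  moreover have "ip p p \<noteq> 0" using pos[OF i0(1)] i0(1) by (auto simp: ip_self_eq_0)
  ultimately have "t = 0" by simp
  then show ?thesis using wt by (simp add: ip_self_eq_0)
next
  case True
  then show ?thesis unfolding ip_def by simp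
qed

end

section \<open>Real spectrum of a symmetric matrix and its sorted eigenvalue list\<close>

lemma eigenvalue_symmetric_real:
  assumes A: "(A :: real mat) \<in> carrier_mat n n"
    and sym: "\<And>i j. i < n \<Longrightarrow> j < n \<Longrightarrow> A $$ (i, j) = A $$ (j, i)"
    and e: "eigenvalue (map_mat complex_of_real A) e"
  shows "e \<in> \<real>"
proof -
  let ?B = "map_mat complex_of_real A"
  obtain v where v: "v \<in> carrier_vec n" "v \<noteq> 0\<^sub>v n" "?B *\<^sub>v v = e \<cdot>\<^sub>v v"
    using e A unfolding eigenvalue_def eigenvector_def by auto
  have Bv: "(\<Sum>j<n. complex_of_real (A $$ (i, j)) * v $ j) = e * v $ i" if "i < n" for i
  proof -
    have "(?B *\<^sub>v v) $ i = e * v $ i" using v that by simp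
    then show ?thesis using A v(1) that by (simp add: scalar_prod_def atLeast0LessThan)
  qed
  \<comment> \<open>The Hermitian form \<open>F\<close> of an eigenvector equals
    \<open>e * N\<close>. Both \<open>F\<close> and \<open>N\<close> are real and \<open>N\<close>
    is nonzero, so \<open>e\<close> is real.\<close>
  define N where "N = (\<Sum>i<n. cnj (v $ i) * v $ i)"
  define F where "F = (\<Sum>i<n. \<Sum>j<n. complex_of_real (A $$ (i, j)) * cnj (v $ i) * v $ j)"
  have "F = (\<Sum>i<n. cnj (v $ i) * (\<Sum>j<n. complex_of_real (A $$ (i, j)) * v $ j))"
    unfolding F_def by (simp add: sum_distrib_left algebra_simps)
  also have "\<dots> = e * N"
    unfolding N_def by (simp add: Bv sum_distrib_left) (simp add: algebra_simps)
  finally have F: "F = e * N" .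
  have "cnj F = (\<Sum>i<n. \<Sum>j<n. complex_of_real (A $$ (i, j)) * v $ i * cnj (v $ j))"
    by (simp add: F_def)
  also have "\<dots> = (\<Sum>j<n. \<Sum>i<n. complex_of_real (A $$ (i, j)) * v $ i * cnj (v $ j))"
    by (rule sum.swap)
  also have "\<dots> = F"
    unfolding F_def by (intro sum.cong refl) (simp add: sym)
  finally have "cnj F = F" .
  have N: "N = complex_of_real (\<Sum>i<n. (cmod (v $ i))\<^sup>2)"
    unfolding N_def by (simp add: complex_norm_square mult.commute del: of_real_power)
  moreover have "(\<Sum>i<n. (cmod (v $ i))\<^sup>2) \<noteq> 0"
  proof
    assume "(\<Sum>i<n. (cmod (v $ i))\<^sup>2) = 0"
    then have "\<forall>i<n. v $ i = 0" by (simp add: sum_nonneg_eq_0_iff)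
    then have "v = 0\<^sub>v n" using v(1) by (intro eq_vecI) auto
    then show False using v by simp
  qed
  ultimately have "N \<noteq> 0" "cnj N = N" by (simp_all only: of_real_eq_0_iff complex_cnj_complex_of_real not_False_eq_True)
  then have "cnj e = e" using F \<open>cnj F = F\<close> by simp
  then show ?thesis by (simp add: Reals_cnj_iff)
qed

text \<open>Keeps the indices of \<open>eigval\<close> in range. The characteristic polynomial
  splits over the complex numbers with real roots only, and the factorization descends because the
  embedding of polynomials is injective.\<close>

lemma size_proots_char_poly_symmetric:
  assumes A: "(A :: real mat) \<in> carrier_mat n n"
    and sym: "\<And>i j. i < n \<Longrightarrow> j < n \<Longrightarrow> A $$ (i, j) = A $$ (j, i)"
  shows "size (proots (char_poly A)) = n"
proof -
  interpret of_real_poly: map_poly_inj_idom_hom complex_of_real ..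
  let ?B = "map_mat complex_of_real A"
  have B: "?B \<in> carrier_mat n n" using A by simp
  obtain as where as: "char_poly ?B = (\<Prod>a\<leftarrow>as. [:- a, 1:])" "length as = n"
    using char_poly_factorized[OF B] by blast
  have "a \<in> \<real>" if "a \<in> set as" for a
  proof (rule eigenvalue_symmetric_real[OF A sym])
    show "eigenvalue ?B a"
      unfolding eigenvalue_root_char_poly[OF B] as(1) poly_prod_list using that
      by (auto simp: prod_list_zero_iff image_iff)
  qed
  then have "\<exists>bs. as = map complex_of_real bs"
    by (intro ex_map_conv[THEN iffD2]) (auto elim: Reals_cases)
  then obtain bs where bs: "as = map complex_of_real bs" by blast
  have "map_poly complex_of_real (char_poly A) = (\<Prod>b\<leftarrow>bs. [:- complex_of_real b, 1:])"
    using of_real_hom.char_poly_hom[OF A, where 'a = complex] as(1) bs by (simp add: comp_def)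
  also have "\<dots> = map_poly complex_of_real (\<Prod>b\<leftarrow>bs. [:- b, 1:])"
    by (simp add: of_real_poly.hom_prod_list comp_def)
  finally have "char_poly A = (\<Prod>b\<leftarrow>bs. [:- b, 1:])" by simp
  moreover have "proots (\<Prod>b\<leftarrow>bs. [:- b, 1:]) = mset bs"
  proof (induction bs)
    case (Cons b bs)
    have "(\<Prod>b\<leftarrow>bs. [:- b, 1:]) \<noteq> 0" by (auto simp: prod_list_zero_iff)
    then show ?case using Cons by (simp add: proots_mult del: mult_pCons_left)
  qed simp
  ultimately have "size (proots (char_poly A)) = length bs" by simp
  then show ?thesis using as(2) bs by simp
qed

text \<open>An eigenvalue other than the first occurs in the decreasing list at the second position
  or later, hence lies between the last and the second entry.\<close>

lemma abs_eigenvalue_le_max: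
  assumes A: "(A :: real mat) \<in> carrier_mat n n"
    and sym: "\<And>i j. i < n \<Longrightarrow> j < n \<Longrightarrow> A $$ (i, j) = A $$ (j, i)"
    and n: "2 \<le> n" and m: "eigenvalue A m" "m \<noteq> eigval A 1"
  shows "\<bar>m\<bar> \<le> max \<bar>eigval A 2\<bar> \<bar>eigval A n\<bar>"
proof -
  define L where "L = rev (sorted_list_of_multiset (proots (char_poly A)))"
  have eigL: "eigval A k = L ! (k - 1)" for k by (simp add: eigval_def L_def)
  have len: "length L = n"
    using size_proots_char_poly_symmetric[OF A sym] by (simp add: L_def flip: size_mset)
  have dec: "L ! j \<le> L ! i" if "i \<le> j" "j < n" for i j
    using that len sorted_wrt_nth_less[of "(\<ge>)" L i j]
    by (cases "i = j") (auto simp: L_def sorted_wrt_rev)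
  have "char_poly A \<noteq> 0" using degree_monic_char_poly[OF A] by auto
  then have "m \<in> set L"
    using m(1) eigenvalue_root_char_poly[OF A] by (simp add: L_def)
  then obtain i where i: "i < n" "L ! i = m" using len by (auto simp: in_set_conv_nth)
  have "0 < i" using m(2) i by (intro gr0I) (auto simp: eigL)
  then have "m \<le> eigval A 2" "eigval A n \<le> m"
    using dec[of 1 i] dec[of i "n - 1"] i n by (simp_all add: eigL)
  then show ?thesis by (simp add: max_def abs_if)
qed

section \<open>Routing an involution\<close>

text \<open>On \<open>Y\<close> the involution \<open>\<sigma> = (\<sigma> \<circ> g) \<circ> g\<close> takes two steps. By maximality of \<open>Y\<close>, no vertex outside is
  fixed or adjacent to its image, and no two pairs \<open>{u, \<sigma> u}, {u', \<sigma> u'}\<close> outside span a 4-cycle.\<close>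

lemma (in pair_graph) route_involution:
  assumes inv: "\<And>v. \<sigma> (\<sigma> v) = v" and perm: "\<sigma> permutes pverts G"
    and path: "\<And>u v W. u \<in> pverts G \<Longrightarrow> v \<in> pverts G \<Longrightarrow> finite W \<Longrightarrow> card W \<le> 4 * (k - 1) \<Longrightarrow>
      \<exists>x y. x \<notin> W \<and> y \<notin> W \<and> (u, x) \<in> parcs G \<and> (x, y) \<in> parcs G \<and> (y, v) \<in> parcs G"
    and deg: "\<And>v. v \<in> pverts G \<Longrightarrow> d \<le> card {w. (v, w) \<in> parcs G}"
  shows "\<exists>m. m \<le> card (pverts G) \<and> m \<le> 4 * (card (pverts G) - d) \<and>
    (\<forall>t. m \<le> t * (2 * k) \<longrightarrow> routable (parcs G) (2 + 3 * t) \<sigma>)"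
proof -
  define V where "V = pverts G"
  define E where "E = parcs G"
  have finV: "finite V" by (simp add: V_def pair_finite_verts)
  have symE: "(x, y) \<in> E \<Longrightarrow> (y, x) \<in> E" for x y
    by (simp add: E_def arcs_symmetric)
  have \<sigma>V: "\<sigma> v \<in> V \<longleftrightarrow> v \<in> V" for v
    using perm by (simp add: V_def permutes_in_image)
  \<comment> \<open>On \<open>Y\<close>, \<open>g\<close> is an involution commuting with
    \<open>\<sigma>\<close>, so \<open>\<sigma> \<circ> g\<close> is one too; both must move
    vertices along arcs. A single maximal \<open>Y\<close> thus absorbs fixed points, adjacent pairs
    and 4-cycles together.\<close>
  define good where "good Y g \<longleftrightarrow> Y \<subseteq> V \<and> (\<forall>y\<in>Y. \<sigma> y \<in> Y \<and> g y \<in> Y \<and> g (g y) = y \<and> g (\<sigma> y) = \<sigma> (g y)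
    \<and> (g y \<noteq> y \<longrightarrow> (y, g y) \<in> E) \<and> (\<sigma> (g y) \<noteq> y \<longrightarrow> (y, \<sigma> (g y)) \<in> E))" for Y g
  have "good {} id" by (simp add: good_def)
  moreover have "card Y < Suc (card V)" if "good Y g" for Y g
    using that finV by (simp add: good_def card_mono le_imp_less_Suc)
  ultimately have "\<exists>p. good (fst p) (snd p) \<and> (\<forall>q. good (fst q) (snd q) \<longrightarrow> card (fst q) \<le> card (fst p))"
    by (intro ex_has_greatest_nat[of "\<lambda>p. good (fst p) (snd p)" "({}, id)" _ "Suc (card V)"]) auto
  then obtain Y g where Y: "good Y g" and Y_max: "\<And>Y' g'. good Y' g' \<Longrightarrow> card Y' \<le> card Y"
    by auto
  have finY: "finite Y" using Y finV by (auto simp: good_def intro: finite_subset)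
  have disjoint_good: "Z = {}" if Z: "good Z h" "Z \<inter> Y = {}" for Z h
  proof -
    have "good (Y \<union> Z) (\<lambda>v. if v \<in> Y then g v else h v)"
      using Y Z unfolding good_def by (auto simp: disjoint_iff)
    then have "card (Y \<union> Z) \<le> card Y" by (rule Y_max)
    moreover have "finite Z" using Z finV by (auto simp: good_def intro: finite_subset)
    ultimately show ?thesis using finY Z(2) by (simp add: card_Un_disjoint Int_commute)
  qed
  define X where "X = V - Y"
  have \<sigma>X: "\<sigma> x \<in> X" if "x \<in> X" for x
    using that Y \<sigma>V inv unfolding X_def good_def by (metis DiffD1 DiffD2 DiffI)
  have X_nonadj: "\<sigma> x \<noteq> x \<and> (x, \<sigma> x) \<notin> E" if x: "x \<in> X" for x
  proof (rule ccontr)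
    assume "\<not> ?thesis"
    then have "good {x, \<sigma> x} id"
      using x \<sigma>V symE unfolding good_def X_def by (auto simp: inv)
    then show False
      using disjoint_good[of "{x, \<sigma> x}" id] x \<sigma>X[OF x] by (auto simp: X_def)
  qed
  have X_pairs: "(u, u') \<notin> E \<or> (u, \<sigma> u') \<notin> E \<or> (\<sigma> u, u') \<notin> E \<or> (\<sigma> u, \<sigma> u') \<notin> E"
    if u: "u \<in> X" "u' \<in> X" "u' \<noteq> u" "u' \<noteq> \<sigma> u" for u u'
  proof (rule ccontr)
    assume adj: "\<not> ?thesis"
    \<comment> \<open>\<open>h\<close> uses two opposite edges of the 4-cycle
      \<open>u, u', \<sigma> u, \<sigma> u'\<close>, and \<open>\<sigma> \<circ> h\<close> uses the
      other two.\<close>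
    define h where "h v = (if v = u then u' else if v = u' then u else if v = \<sigma> u then \<sigma> u' else \<sigma> u)" for v
    have ne: "\<sigma> u \<noteq> u" "\<sigma> u' \<noteq> u'" "\<sigma> u' \<noteq> u" "\<sigma> u' \<noteq> \<sigma> u"
      using X_nonadj u inv by metis+
    have h: "h u = u'" "h u' = u" "h (\<sigma> u) = \<sigma> u'" "h (\<sigma> u') = \<sigma> u"
      using ne u by (auto simp: h_def)
    have "good {u, u', \<sigma> u, \<sigma> u'} h"
      using u \<sigma>V adj symE unfolding good_def X_def by (auto simp: inv h)
    then show False
      using disjoint_good u \<sigma>X by (fastforce simp: X_def)
  qed
  have "card X \<le> card V" unfolding X_def using finV by (simp add: card_mono)
  moreover have "card X \<le> 4 * (card V - d)"
  proof (cases "X = {}")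
    case False
    then obtain u where u: "u \<in> X" by blast
    define N where "N v = {w. (v, w) \<in> E}" for v
    \<comment> \<open>Non-neighbours of \<open>u\<close> or of \<open>\<sigma> u\<close>, at most
      \<open>2 * (card V - d)\<close> in number. Another pair in \<open>X\<close> with neither
      member in \<open>Q\<close> would span a 4-cycle with \<open>u, \<sigma> u\<close>, so
      \<open>Q\<close> and its image under \<open>\<sigma>\<close> cover \<open>X\<close>.\<close>
    define Q where "Q = (V - N u) \<union> (V - N (\<sigma> u))"
    have NV: "card (V - N v) \<le> card V - d" if "v \<in> X" for v
    proof -
      have "N v \<subseteq> V" unfolding N_def E_def V_def using in_arcsD2 by auto
      moreover have "d \<le> card (N v)"
        using deg that by (simp add: N_def E_def X_def V_def)
      ultimately show ?thesis using finV by (simp add: card_Diff_subset finite_subset)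
    qed
    have "X \<subseteq> Q \<union> \<sigma> ` Q"
    proof
      fix x assume x: "x \<in> X"
      show "x \<in> Q \<union> \<sigma> ` Q"
      proof (cases "x = u \<or> x = \<sigma> u")
        case True
        then show ?thesis
          using x no_loops' by (auto simp: Q_def N_def E_def X_def)
      next
        case False
        then have "x \<in> Q \<or> \<sigma> x \<in> Q"
          using X_pairs[OF u x] x \<sigma>V by (auto simp: Q_def N_def X_def)
        then show ?thesis using inv by (metis UnCI imageI)
      qed
    qed
    then have "card X \<le> card (Q \<union> \<sigma> ` Q)"
      using finV by (intro card_mono) (auto simp: Q_def)
    also have "\<dots> \<le> card Q + card Q"
      using card_Un_le[of Q "\<sigma> ` Q"] card_image_le[of Q \<sigma>] finV by (simp add: Q_def)
    also have "card Q \<le> (card V - d) + (card V - d)"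
      unfolding Q_def using card_Un_le NV[OF u] NV[OF \<sigma>X[OF u]] by (meson add_mono order_trans)
    finally show ?thesis by simp
  qed simp
  moreover have "routable E (2 + 3 * t) \<sigma>" if "card X \<le> t * (2 * k)" for t
  proof -
    have "routable E (3 * t) (restr \<sigma> X)"
      unfolding E_def using X_nonadj \<sigma>X that
      by (intro route_batches[OF inv path]) (auto simp: E_def X_def V_def)
    moreover have "routable E (1 + 1) (restr (\<sigma> \<circ> g) Y \<circ> restr g Y)"
      using Y inv by (intro routable_comp routable_single) (auto simp: restr_def good_def)
    moreover have "\<sigma> = restr \<sigma> X \<circ> (restr (\<sigma> \<circ> g) Y \<circ> restr g Y)"
      using Y perm unfolding X_def V_def restr_def good_def permutes_def by (auto simp: fun_eq_iff)
    ultimately show ?thesis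
      using routable_comp[of E "3 * t" "restr \<sigma> X" "1 + 1"] by (metis one_add_one)
  qed
  ultimately show ?thesis unfolding V_def E_def by blast
qed

text \<open>Collects the combinatorial half. The factor 2 in the budget stands for the two
  involutions; \<open>m\<close> is the number of vertices left for the batches, which varies with
  the involution.\<close>

lemma (in pair_graph) routing_number_le:
  fixes B :: real
  assumes path: "\<And>u v W. u \<in> pverts G \<Longrightarrow> v \<in> pverts G \<Longrightarrow> finite W \<Longrightarrow> card W \<le> 4 * (k - 1) \<Longrightarrow>
      \<exists>x y. x \<notin> W \<and> y \<notin> W \<and> (u, x) \<in> parcs G \<and> (x, y) \<in> parcs G \<and> (y, v) \<in> parcs G"
    and deg: "\<And>v. v \<in> pverts G \<Longrightarrow> d \<le> card {w. (v, w) \<in> parcs G}"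
    and B: "\<And>m. m \<le> card (pverts G) \<Longrightarrow> m \<le> 4 * (card (pverts G) - d) \<Longrightarrow>
      \<exists>t. m \<le> t * (2 * k) \<and> 2 * (2 + 3 * real t) \<le> B"
  shows "real (routing_number G) \<le> B"
proof -
  have invol: "\<exists>j. 2 * real j \<le> B \<and> routable (parcs G) j \<sigma>"
    if \<sigma>: "\<forall>v. \<sigma> (\<sigma> v) = v" "\<sigma> permutes pverts G" for \<sigma>
  proof -
    obtain m where m: "m \<le> card (pverts G)" "m \<le> 4 * (card (pverts G) - d)"
      "\<And>t. m \<le> t * (2 * k) \<Longrightarrow> routable (parcs G) (2 + 3 * t) \<sigma>"
      using route_involution[OF _ \<sigma>(2) path deg] \<sigma>(1) by blast
    then obtain t where "m \<le> t * (2 * k)" "2 * (2 + 3 * real t) \<le> B" using B by blast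
    then show ?thesis using m(3) by (intro exI[of _ "2 + 3 * t"]) simp
  qed
  have le: "real (routing_number_of G \<pi>) \<le> B" if perm: "\<pi> permutes pverts G" for \<pi>
  proof -
    obtain \<sigma> \<tau> where \<pi>: "\<pi> = \<tau> \<circ> \<sigma>" "\<forall>v. \<sigma> (\<sigma> v) = v" "\<forall>v. \<tau> (\<tau> v) = v"
      "\<sigma> permutes pverts G" "\<tau> permutes pverts G"
      using permutes_involutions[OF perm pair_finite_verts] by blast
    obtain i j where "2 * real i \<le> B" "2 * real j \<le> B"
      "routable (parcs G) i \<sigma>" "routable (parcs G) j \<tau>"
      using invol \<pi> by metis
    then show ?thesis
      using routing_number_of_le[OF routable_comp, of j \<tau> i \<sigma>] unfolding \<pi>(1) by linarith
  qed
  let ?R = "{routing_number_of G \<pi> | \<pi>. \<pi> permutes pverts G}"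
  have "?R = routing_number_of G ` {\<pi>. \<pi> permutes pverts G}" by blast
  then have "finite ?R" using finite_permutations[OF pair_finite_verts] by simp
  moreover have "?R \<noteq> {}" using permutes_id by blast
  ultimately have "Max ?R \<in> ?R" by (rule Max_in)
  then show ?thesis unfolding routing_number_def using le by auto
qed

section \<open>Expansion\<close>

text \<open>Connectedness as irreducibility: a set that no arc leaves contains everything reachable
  from it, and by symmetry of the arcs every vertex is reachable.\<close>

lemma (in pair_graph) connected_leaving_arc:
  assumes conn: "connected (with_proj G)" and Z: "u \<in> Z" "v \<in> pverts G" "v \<notin> Z" "u \<in> pverts G"
  shows "\<exists>x\<in>Z. \<exists>y. y \<notin> Z \<and> (x, y) \<in> parcs G"
proof (rule ccontr)
  assume none: "\<not> ?thesis"
  have "strongly_connected (with_proj G)"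
    using conn pair_sym_arcs by (intro symmetric_connected_imp_strongly_connected)
  then have "u \<rightarrow>\<^sup>*\<^bsub>with_proj G\<^esub> v"
    using Z by (auto simp: strongly_connected_def)
  then have "v \<in> Z"
  proof (induction rule: reachable_induct)
    case base
    show ?case by (rule Z(1))
  next
    case (step x y)
    then show ?case using none by auto
  qed
  then show False using Z by simp
qed

section \<open>The graph with its Perron vector, and edges between large vertex sets\<close>

locale perron_graph = pair_graph G for G :: "'a pair_pre_digraph" +
  fixes vs :: "'a list" and A :: "real mat" and \<nu> :: "real vec" and n :: nat
  assumes conn: "connected (with_proj G)"
    and n_card: "card (pverts G) = n" and n_ge: "2 \<le> n"
    and vs: "distinct vs" "set vs = pverts G"
    and A_def: "A = adjacency_matrix G vs"
    and perron: "normalized_perron_vector A \<nu>"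
begin

lemma length_vs: "length vs = n"
  using vs n_card distinct_card by metis

lemma A_carrier: "A \<in> carrier_mat n n"
  by (simp add: A_def adjacency_matrix_def length_vs)

lemma A_index: "i < n \<Longrightarrow> j < n \<Longrightarrow> A $$ (i, j) = (if (vs ! i, vs ! j) \<in> parcs G then 1 else 0)"
  by (simp add: A_def adjacency_matrix_def length_vs)

lemma A_sym: "i < n \<Longrightarrow> j < n \<Longrightarrow> A $$ (i, j) = A $$ (j, i)"
  using arcs_symmetric by (auto simp: A_index)

sublocale form: symmetric_form n "\<lambda>i j. A $$ (i, j)"
  by unfold_locales (rule A_sym)

lemma pverts_eq: "pverts G = (!) vs ` {..<n}"
  using vs(2) length_vs by (auto simp: set_conv_nth)

lemma inj_vs: "inj_on ((!) vs) {..<n}"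
  using vs(1) length_vs by (intro inj_on_nth) auto

lemma card_index: "U \<subseteq> pverts G \<Longrightarrow> card {i. i < n \<and> vs ! i \<in> U} = card U"
proof -
  assume "U \<subseteq> pverts G"
  then have "(!) vs ` {i. i < n \<and> vs ! i \<in> U} = U"
    unfolding pverts_eq by blast
  moreover have "inj_on ((!) vs) {i. i < n \<and> vs ! i \<in> U}"
    by (rule inj_on_subset[OF inj_vs]) auto
  ultimately show ?thesis by (metis card_image)
qed

lemma dim_\<nu>: "dim_vec \<nu> = n"
  using perron A_carrier by (auto simp: normalized_perron_vector_def eigenvector_def)

lemma \<nu>_pos: "i < n \<Longrightarrow> 0 < \<nu> $ i"
  using perron by (simp add: normalized_perron_vector_def dim_\<nu>)

lemma \<nu>_eig: "i < n \<Longrightarrow> form.op (($) \<nu>) i = eigval A 1 * \<nu> $ i"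
proof -
  assume i: "i < n"
  have "A *\<^sub>v \<nu> = eigval A 1 \<cdot>\<^sub>v \<nu>"
    using perron by (simp add: normalized_perron_vector_def eigenvector_def)
  then have "(A *\<^sub>v \<nu>) $ i = eigval A 1 * \<nu> $ i" using i dim_\<nu> by simp
  then show ?thesis
    using i A_carrier dim_\<nu> by (simp add: form.op_def scalar_prod_def atLeast0LessThan)
qed

lemma \<nu>_norm: "form.ip (($) \<nu>) (($) \<nu>) = 1"
  using perron by (simp add: normalized_perron_vector_def form.ip_def scalar_prod_def dim_\<nu>
      atLeast0LessThan)

lemma eigval1_nonneg: "0 \<le> eigval A 1"
proof -
  have "0 \<le> form.op (($) \<nu>) 0"
    unfolding form.op_def using n_ge \<nu>_pos
    by (intro sum_nonneg mult_nonneg_nonneg) (auto simp: A_index less_imp_le)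
  then show ?thesis
    using \<nu>_eig[of 0] \<nu>_pos[of 0] n_ge by (simp add: zero_le_mult_iff)
qed

lemma min_entry_le: "i < n \<Longrightarrow> min_entry \<nu> \<le> \<nu> $ i"
  and min_entry_pos: "0 < min_entry \<nu>"
proof -
  have eq: "min_entry \<nu> = Min ((\<lambda>i. \<nu> $ i) ` {..<n})"
    unfolding min_entry_def dim_\<nu> by (rule arg_cong[of _ _ Min]) auto
  show "i < n \<Longrightarrow> min_entry \<nu> \<le> \<nu> $ i"
    unfolding eq by (intro Min_le) auto
  have "min_entry \<nu> \<in> (\<lambda>i. \<nu> $ i) ` {..<n}"
    unfolding eq using n_ge by (intro Min_in) (auto simp: lessThan_empty_iff)
  then show "0 < min_entry \<nu>" using \<nu>_pos by auto
qed

text \<open>The extremal value \<open>m\<close> on the complement of \<open>\<nu>\<close> is an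
  eigenvalue. It differs from the largest one, since for a connected graph an eigenvector orthogonal
  to \<open>\<nu>\<close> cannot share the eigenvalue of \<open>\<nu>\<close>.\<close>

lemma spectral_bound:
  obtains m where "\<bar>m\<bar> \<le> max \<bar>eigval A 2\<bar> \<bar>eigval A n\<bar>"
    "\<And>x. form.ip x (($) \<nu>) = 0 \<Longrightarrow> \<bar>form.ip x (form.op x)\<bar> \<le> \<bar>m\<bar> * form.ip x x"
proof -
  have nz: "\<nu> $ 0 \<noteq> 0" using \<nu>_pos[of 0] n_ge by simp
  obtain w m where w: "form.ip w w = 1" "form.ip w (($) \<nu>) = 0" "\<And>i. i < n \<Longrightarrow> form.op w i = m * w i"
    and m: "\<And>x. form.ip x (($) \<nu>) = 0 \<Longrightarrow> \<bar>form.ip x (form.op x)\<bar> \<le> \<bar>m\<bar> * form.ip x x"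
    using form.extremal_eigenvector[where p = "($) \<nu>", OF n_ge nz \<nu>_eig] by blast
  have "m \<noteq> eigval A 1"
  proof
    assume m1: "m = eigval A 1"
    have irred: "\<exists>i\<in>Z. \<exists>j\<in>{..<n} - Z. A $$ (i, j) \<noteq> 0" if Z: "Z \<subset> {..<n}" "Z \<noteq> {}" for Z
    proof -
      obtain i j where ij: "i \<in> Z" "j < n" "j \<notin> Z" using Z by blast
      have in_vs: "vs ! k \<in> pverts G" if "k < n" for k
        using that pverts_eq by blast
      have inj: "vs ! k \<in> (!) vs ` Z \<longleftrightarrow> k \<in> Z" if "k < n" for k
        using that Z(1) inj_vs by (intro inj_on_image_mem_iff) auto
      have "\<exists>x\<in>(!) vs ` Z. \<exists>y. y \<notin> (!) vs ` Z \<and> (x, y) \<in> parcs G"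
      proof (rule connected_leaving_arc[OF conn])
        have "i < n" using ij Z by blast
        then show "vs ! i \<in> (!) vs ` Z" "vs ! j \<in> pverts G" "vs ! j \<notin> (!) vs ` Z" "vs ! i \<in> pverts G"
          using ij in_vs inj by auto
      qed
      then obtain k y where k: "k \<in> Z" "y \<notin> (!) vs ` Z" "(vs ! k, y) \<in> parcs G" by blast
      then obtain l where "l < n" "y = vs ! l"
        using in_arcsD2 pverts_eq by blast
      moreover have "k < n" using k(1) Z(1) by blast
      ultimately have "l \<in> {..<n} - Z" "A $$ (k, l) \<noteq> 0"
        using k by (auto simp: A_index)
      then show ?thesis using k(1) by blast
    qed
    have "form.ip w w = 0"
    proof (rule form.positive_eigenvector_unique[where p = "($) \<nu>" and l = m])
      show "form.op (($) \<nu>) i = m * \<nu> $ i" if "i < n" for i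
        using \<nu>_eig[OF that] by (simp only: m1)
    qed (use \<nu>_pos irred w in \<open>auto simp: A_index\<close>)
    then show False using w(1) by simp
  qed
  moreover have "eigenvalue A m"
  proof -
    have "A *\<^sub>v vec n w = m \<cdot>\<^sub>v vec n w"
      using A_carrier w(3)
      by (intro eq_vecI) (auto simp: form.op_def scalar_prod_def atLeast0LessThan)
    moreover have "vec n w \<noteq> 0\<^sub>v n"
    proof
      assume "vec n w = 0\<^sub>v n"
      then have "\<forall>i<n. w i = 0" by (metis index_vec index_zero_vec(1))
      then show False using w(1) form.ip_self_eq_0[of w] by simp
    qed
    ultimately show ?thesis
      using A_carrier unfolding eigenvalue_def eigenvector_def by (intro exI[of _ "vec n w"]) auto
  qed
  ultimately have "\<bar>m\<bar> \<le> max \<bar>eigval A 2\<bar> \<bar>eigval A n\<bar>"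
    using abs_eigenvalue_le_max[OF A_carrier A_sym n_ge] by blast
  then show thesis using that m by blast
qed

text \<open>Split the indicators of \<open>S\<close> and \<open>T\<close> into their components
  \<open>\<alpha>\<close>, \<open>\<beta>\<close> along \<open>\<nu>\<close> and orthogonal
  remainders. Without an arc, the Perron part \<open>eigval A 1 * \<alpha> * \<beta>\<close> is
  cancelled by the form of the remainders, which is too small because \<open>\<alpha>\<close> and
  \<open>\<beta>\<close> are at least \<open>min_entry \<nu> * s\<close>.\<close>

lemma expander_arc:
  assumes S: "S \<subseteq> pverts G" "card S = s" and T: "T \<subseteq> pverts G" "card T = s"
    and gap: "max \<bar>eigval A 2\<bar> \<bar>eigval A n\<bar> < eigval A 1 * (min_entry \<nu>)\<^sup>2 * real s"
  shows "\<exists>x\<in>S. \<exists>y\<in>T. (x, y) \<in> parcs G"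
proof (rule ccontr)
  assume none: "\<not> ?thesis"
  obtain m where m: "\<bar>m\<bar> \<le> max \<bar>eigval A 2\<bar> \<bar>eigval A n\<bar>"
    "\<And>x. form.ip x (($) \<nu>) = 0 \<Longrightarrow> \<bar>form.ip x (form.op x)\<bar> \<le> \<bar>m\<bar> * form.ip x x"
    using spectral_bound by blast
  define ind where "ind U i = (if vs ! i \<in> U then 1 else 0 :: real)" for U i
  have sum_ind: "(\<Sum>i<n. ind U i * f i) = (\<Sum>i \<in> {i. i < n \<and> vs ! i \<in> U}. f i)" for U f
    by (rule sum.mono_neutral_cong_right) (auto simp: ind_def)
  have ip_ind: "form.ip (ind U) (ind U) = real (card U)" if "U \<subseteq> pverts G" for U
    unfolding form.ip_def sum_ind card_index[OF that, symmetric] by (simp add: ind_def)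
  let ?p = "($) \<nu>" and ?l = "eigval A 1" and ?\<mu> = "min_entry \<nu>"
  have ip_\<nu>: "?\<mu> * real (card U) \<le> form.ip (ind U) ?p" if "U \<subseteq> pverts G" for U
    unfolding form.ip_def sum_ind card_index[OF that, symmetric]
    using sum_bounded_below[of "{i. i < n \<and> vs ! i \<in> U}" ?\<mu> ?p] min_entry_le
    by (simp add: mult.commute)
  have ip_op_\<nu>: "form.ip x (form.op ?p) = ?l * form.ip x ?p" for x
    by (simp add: form.ip_def \<nu>_eig sum_distrib_left algebra_simps)
  define \<alpha> \<beta> where "\<alpha> = form.ip (ind S) ?p" and "\<beta> = form.ip (ind T) ?p"
  define x y where "x = (\<lambda>i. ind S i + (- \<alpha>) * ?p i)" and "y = (\<lambda>i. ind T i + (- \<beta>) * ?p i)"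
  have "form.ip (ind S) (form.op (ind T)) = 0"
    unfolding form.ip_def form.op_def using none
    by (intro sum.neutral ballI) (auto simp: ind_def A_index intro!: sum.neutral)
  then have xy: "form.ip x (form.op y) = - ?l * \<alpha> * \<beta>"
    unfolding x_def y_def form.op_add form.ip_add form.ip_add_right ip_op_\<nu> \<nu>_norm
      form.ip_op[of ?p "ind T"] \<alpha>_def[symmetric] \<beta>_def[symmetric] by (simp add: algebra_simps)
  have "form.ip x ?p = 0" "form.ip y ?p = 0"
    unfolding x_def y_def form.ip_add \<nu>_norm by (simp_all add: \<alpha>_def \<beta>_def)
  then have "2 * \<bar>form.ip x (form.op y)\<bar> \<le> \<bar>m\<bar> * (form.ip x x + form.ip y y)"
    using form.polarization_bound m(2) by blast
  moreover have "form.ip x x = real s - \<alpha>\<^sup>2" "form.ip y y = real s - \<beta>\<^sup>2"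
    unfolding x_def y_def form.self_add \<nu>_norm using ip_ind S T
    by (simp_all add: \<alpha>_def \<beta>_def form.ip_commute[of ?p] power2_eq_square)
  ultimately have "2 * \<bar>?l * \<alpha> * \<beta>\<bar> \<le> \<bar>m\<bar> * (2 * real s - (\<alpha>\<^sup>2 + \<beta>\<^sup>2))"
    unfolding xy by (simp add: algebra_simps)
  also have "\<dots> \<le> \<bar>m\<bar> * (2 * real s)"
    by (intro mult_left_mono) auto
  also have "\<dots> \<le> max \<bar>eigval A 2\<bar> \<bar>eigval A n\<bar> * (2 * real s)"
    using m(1) by (intro mult_right_mono) auto
  finally have upper: "?l * \<alpha> * \<beta> \<le> max \<bar>eigval A 2\<bar> \<bar>eigval A n\<bar> * real s"
    by linarith
  have "(?\<mu> * real s) * (?\<mu> * real s) \<le> \<alpha> * \<beta>"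
  proof (rule mult_mono)
    show \<alpha>: "?\<mu> * real s \<le> \<alpha>" and "?\<mu> * real s \<le> \<beta>"
      using ip_\<nu>[OF S(1)] ip_\<nu>[OF T(1)] S(2) T(2) by (simp_all add: \<alpha>_def \<beta>_def)
    show nn: "0 \<le> ?\<mu> * real s" using min_entry_pos by simp
    show "0 \<le> \<alpha>" using \<alpha> nn by linarith
  qed
  then have "?l * ((?\<mu> * real s) * (?\<mu> * real s)) \<le> ?l * (\<alpha> * \<beta>)"
    using eigval1_nonneg by (rule mult_left_mono)
  then have "(?l * ?\<mu>\<^sup>2 * real s) * real s \<le> max \<bar>eigval A 2\<bar> \<bar>eigval A n\<bar> * real s"
    using upper by (simp add: power2_eq_square algebra_simps)
  \<comment> \<open>For \<open>s = 0\<close> the gap would make a maximum of absolute values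
    negative.\<close>
  moreover have "0 < real s"
    using gap by (cases "s = 0") auto
  ultimately have "?l * ?\<mu>\<^sup>2 * real s \<le> max \<bar>eigval A 2\<bar> \<bar>eigval A n\<bar>"
    by (rule mult_right_le_imp_le)
  then show False using gap by linarith
qed

text \<open>Removing \<open>W\<close> leaves at least \<open>d - r\<close> neighbours of
  \<open>u\<close> and of \<open>v\<close>; an arc between the two remaining sets is the middle of
  the path.\<close>

lemma short_path:
  assumes deg: "\<And>v. v \<in> pverts G \<Longrightarrow> d \<le> card {w. (v, w) \<in> parcs G}"
    and r: "r \<le> d"
    and gap: "max \<bar>eigval A 2\<bar> \<bar>eigval A n\<bar> < eigval A 1 * (min_entry \<nu>)\<^sup>2 * real (d - r)"
    and uv: "u \<in> pverts G" "v \<in> pverts G" and W: "finite W" "card W \<le> r"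
  shows "\<exists>x y. x \<notin> W \<and> y \<notin> W \<and> (u, x) \<in> parcs G \<and> (x, y) \<in> parcs G \<and> (y, v) \<in> parcs G"
proof -
  have "\<exists>S \<subseteq> {w. (z, w) \<in> parcs G} - W. card S = d - r" if "z \<in> pverts G" for z
  proof -
    have "d - r \<le> card {w. (z, w) \<in> parcs G} - card W"
      using deg[OF that] W by linarith
    also have "\<dots> \<le> card ({w. (z, w) \<in> parcs G} - W)"
      using W(1) by (rule diff_card_le_card_Diff)
    finally show ?thesis by (metis obtain_subset_with_card_n)
  qed
  then obtain S T where S: "S \<subseteq> {w. (u, w) \<in> parcs G} - W" "card S = d - r"
    and T: "T \<subseteq> {w. (v, w) \<in> parcs G} - W" "card T = d - r"
    using uv by metis
  moreover have "S \<subseteq> pverts G" "T \<subseteq> pverts G"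
    using S T in_arcsD2 by auto
  ultimately obtain x y where "x \<in> S" "y \<in> T" "(x, y) \<in> parcs G"
    using expander_arc[of S "d - r" T] gap by blast
  then show ?thesis using S T arcs_symmetric by blast
qed

text \<open>Cauchy-Schwarz on the eigenvalue equation at \<open>v\<close>: the \<open>n - d\<close>
  vertices outside its neighbourhood carry at least
  \<open>(n - d) * (min_entry \<nu>)\<^sup>2\<close> of the unit mass of
  \<open>\<nu>\<close>.\<close>

lemma perron_degree_bound:
  assumes v: "v \<in> pverts G" and d: "card {w. (v, w) \<in> parcs G} = d"
  shows "(eigval A 1 * (min_entry \<nu>)\<^sup>2)\<^sup>2 \<le> real d * (min_entry \<nu>)\<^sup>2 * (1 - real (n - d) * (min_entry \<nu>)\<^sup>2)"
    and "real n * (min_entry \<nu>)\<^sup>2 \<le> 1"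
proof -
  let ?l = "eigval A 1" and ?\<mu> = "min_entry \<nu>"
  obtain i where i: "i < n" "vs ! i = v"
    using v unfolding pverts_eq by auto
  define N where "N = {j. j < n \<and> (v, vs ! j) \<in> parcs G}"
  have N: "finite N" "N \<subseteq> {..<n}" by (auto simp: N_def)
  have "{w. (v, w) \<in> parcs G} \<subseteq> pverts G" using in_arcsD2 by auto
  then have "card {j. j < n \<and> vs ! j \<in> {w. (v, w) \<in> parcs G}} = d"
    by (simp only: card_index d)
  then have cN: "card N = d" by (simp add: N_def)
  have sq: "?\<mu>\<^sup>2 \<le> (\<nu> $ j)\<^sup>2" if "j < n" for j
    using min_entry_le[OF that] min_entry_pos by (intro power_mono) auto
  have norm: "(\<Sum>j<n. (\<nu> $ j)\<^sup>2) = 1"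
    using \<nu>_norm by (simp add: form.ip_def power2_eq_square)
  show "real n * ?\<mu>\<^sup>2 \<le> 1"
    using sum_bounded_below[of "{..<n}" "?\<mu>\<^sup>2" "\<lambda>j. (\<nu> $ j)\<^sup>2"] sq norm by simp
  have "real (n - d) * ?\<mu>\<^sup>2 \<le> (\<Sum>j\<in>{..<n} - N. (\<nu> $ j)\<^sup>2)"
    using sum_bounded_below[of "{..<n} - N" "?\<mu>\<^sup>2" "\<lambda>j. (\<nu> $ j)\<^sup>2"] sq N cN
    by (simp add: card_Diff_subset)
  also have "\<dots> = 1 - (\<Sum>j\<in>N. (\<nu> $ j)\<^sup>2)"
    using sum.subset_diff[of N "{..<n}" "\<lambda>j. (\<nu> $ j)\<^sup>2"] N norm by simp
  finally have sumN: "(\<Sum>j\<in>N. (\<nu> $ j)\<^sup>2) \<le> 1 - real (n - d) * ?\<mu>\<^sup>2" by simp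
  have "?l * \<nu> $ i = (\<Sum>j\<in>N. \<nu> $ j)"
    unfolding \<nu>_eig[OF i(1), symmetric] form.op_def
    by (rule sum.mono_neutral_cong_right) (auto simp: N_def A_index i)
  then have "(?l * \<nu> $ i)\<^sup>2 \<le> (\<Sum>j\<in>N. (\<nu> $ j)\<^sup>2) * real d"
    using sum_squared_le_sum_of_squares[of "\<lambda>j. \<nu> $ j" N] cN by simp
  also have "\<dots> \<le> (1 - real (n - d) * ?\<mu>\<^sup>2) * real d"
    using sumN by (intro mult_right_mono) auto
  finally have "(?l * \<nu> $ i)\<^sup>2 \<le> (1 - real (n - d) * ?\<mu>\<^sup>2) * real d" .
  moreover have "(?l * ?\<mu>)\<^sup>2 \<le> (?l * \<nu> $ i)\<^sup>2"
    using min_entry_le[OF i(1)] min_entry_pos eigval1_nonneg by (intro power_mono mult_left_mono) auto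
  ultimately have "(?l * ?\<mu>)\<^sup>2 * ?\<mu>\<^sup>2 \<le> ((1 - real (n - d) * ?\<mu>\<^sup>2) * real d) * ?\<mu>\<^sup>2"
    by (intro mult_right_mono) auto
  then show "(?l * ?\<mu>\<^sup>2)\<^sup>2 \<le> real d * ?\<mu>\<^sup>2 * (1 - real (n - d) * ?\<mu>\<^sup>2)"
    by (simp add: power2_eq_square algebra_simps)
qed

end

section \<open>Numerical estimates\<close>

lemma perron_weight_le:
  fixes \<mu> c y :: real
  assumes \<mu>: "0 \<le> \<mu>" "\<mu>\<^sup>2 \<le> c * y * (1 - (1 - c) * y)" and c: "0 < c" "c < 1" and y: "0 \<le> y" "y \<le> 1"
  shows "\<mu> \<le> 1" and "1 / 2 \<le> c \<Longrightarrow> \<mu> \<le> c"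
proof -
  have "c * y * (1 - (1 - c) * y) \<le> 1 * 1 * 1"
    using c y by (intro mult_mono mult_nonneg_nonneg) (auto intro: mult_le_one mult_nonneg_nonneg)
  then have "\<mu>\<^sup>2 \<le> 1\<^sup>2" using \<mu> by simp
  then show "\<mu> \<le> 1" by (rule power2_le_imp_le) simp
  assume half: "1 / 2 \<le> c"
  have "(1 - c) * y \<le> 1 - c" using y c by (simp add: mult_left_le)
  \<comment> \<open>This product is exactly \<open>c\<^sup>2 - c * y * (1 - (1 - c) * y)\<close>;
    its last factor is nonnegative because \<open>1 - c \<le> c\<close>.\<close>
  then have "0 \<le> c * ((1 - y) * (c - (1 - c) * y))"
    using y c half by (intro mult_nonneg_nonneg) linarith+
  then have "c * y * (1 - (1 - c) * y) \<le> c\<^sup>2"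
    by (simp add: power2_eq_square algebra_simps)
  then have "\<mu>\<^sup>2 \<le> c\<^sup>2" using \<mu> by simp
  then show "\<mu> \<le> c" by (rule power2_le_imp_le) (use c in simp)
qed

text \<open>Of the 5, two steps open the routing of an involution and three pay for rounding up the
  number of batches; \<open>6 * \<mu> * m / g\<close> bounds the cost of the batches before
  rounding.\<close>

lemma step_count_le:
  fixes \<mu> c n m g :: real
  assumes c: "0 < c" "c < 1" and \<mu>: "0 < \<mu>" "\<mu> \<le> 1" "1 / 2 \<le> c \<Longrightarrow> \<mu> \<le> c"
    and n: "0 < n" and m: "0 \<le> m" "m \<le> n" "m \<le> 4 * (1 - c) * n" and g: "0 < g" "g \<le> \<mu> * c * n"
  shows "5 + 6 * \<mu> * m / g \<le> 6 * n / (c * g)"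
proof -
  have "5 * c * g + 6 * c * \<mu> * m \<le> \<mu> * c * (5 * c * n + 6 * m)"
    using mult_left_mono[OF g(2), of "5 * c"] c by (simp add: algebra_simps)
  \<comment> \<open>For large \<open>c\<close> the bounds \<open>\<mu> \<le> c\<close> and
    \<open>m \<le> 4 * (1 - c) * n\<close> are used; for \<open>c < 1 / 2\<close> the crude
    \<open>\<mu> \<le> 1\<close> and \<open>m \<le> n\<close> already give
    \<open>17 / 4 * n\<close>.\<close>
  also have "\<dots> \<le> 6 * n"
  proof (cases "1 / 2 \<le> c")
    case True
    have "\<mu> * c * (5 * c * n + 6 * m) \<le> c * c * (5 * c * n + 6 * (4 * (1 - c) * n))"
      using True c n m \<mu> by (intro mult_mono add_mono) auto
    \<comment> \<open>\<open>24 c\<^sup>2 - 19 c\<^sup>3\<close> is largest at \<open>c = 16 / 19\<close>, which \<open>21 / 25\<close> approximates.\<close>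
    also have "\<dots> = 6 * n - ((c - 21 / 25)\<^sup>2 * (19 * c + 198 / 25) + (6 - 198 / 25 * (21 / 25)\<^sup>2 - 63 / 625 * c)) * n"
      by (simp add: power2_eq_square field_simps)
    also have "\<dots> \<le> 6 * n"
    proof -
      have "0 \<le> (c - 21 / 25)\<^sup>2 * (19 * c + 198 / 25)"
        using c by (intro mult_nonneg_nonneg) auto
      moreover have "0 \<le> 6 - 198 / 25 * (21 / 25)\<^sup>2 - 63 / 625 * c"
        using c by (simp add: power2_eq_square)
      ultimately show ?thesis using n by simp
    qed
    finally show ?thesis .
  next
    case False
    have "\<mu> * c * (5 * c * n + 6 * m) \<le> 1 * (1 / 2) * (5 * (1 / 2) * n + 6 * n)"
      using False c n m \<mu> by (intro mult_mono add_mono) auto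
    then show ?thesis using n by simp
  qed
  finally have "(5 * c * g + 6 * c * \<mu> * m) / (c * g) \<le> 6 * n / (c * g)"
    using c g by (intro divide_right_mono) auto
  moreover have "(5 * c * g + 6 * c * \<mu> * m) / (c * g) = 5 + 6 * \<mu> * m / g"
    using c g by (simp add: field_simps)
  ultimately show ?thesis by simp
qed

theorem theorem26:
  fixes c lam :: real and n :: nat
    and G :: "'a pair_pre_digraph" and vs :: "'a list" and A :: "real mat" and \<nu> :: "real vec"
  assumes c: "0 < c" "c < 1"
    and graph: "pair_graph G" "connected (with_proj G)"
    and n: "card (pverts G) = n" "n \<ge> 2"
    and min_degree: "real (min_degree G) = c * real n"
    and vs: "distinct vs" "set vs = pverts G"
    and A: "A = adjacency_matrix G vs"
    and \<nu>: "normalized_perron_vector A \<nu>"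
    and lam: "lam = max \<bar>eigval A 2\<bar> \<bar>eigval A n\<bar>"
    and gap: "lam < eigval A 1 * c * real n * (min_entry \<nu>)^2"
  shows "real (routing_number G)
           \<le> 12 * real n / (c * (eigval A 1 * c * real n * (min_entry \<nu>)^2 - lam))"
proof -
  interpret perron_graph G vs A \<nu> n
    using graph n vs A \<nu> by (auto simp: perron_graph_def perron_graph_axioms_def)
  define d where "d = min_degree G"
  define \<mu> where "\<mu> = eigval A 1 * (min_entry \<nu>)\<^sup>2"
  define g where "g = \<mu> * c * real n - lam"
  have d: "real d = c * real n" using min_degree by (simp add: d_def)
  have g_eq: "eigval A 1 * c * real n * (min_entry \<nu>)^2 - lam = g"
    by (simp add: g_def \<mu>_def algebra_simps)
  have "0 \<le> lam" using lam by simp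
  have g: "0 < g" "g \<le> \<mu> * c * real n"
    using gap g_eq \<open>0 \<le> lam\<close> by linarith (simp add: g_def \<open>0 \<le> lam\<close>)
  have \<mu>_nonneg: "0 \<le> \<mu>" unfolding \<mu>_def by (intro mult_nonneg_nonneg eigval1_nonneg) simp
  have "\<mu> \<noteq> 0" using g(1) \<open>0 \<le> lam\<close> by (auto simp: g_def)
  then have \<mu>: "0 < \<mu>" using \<mu>_nonneg by simp
  have out_degree: "out_degree (with_proj G) v = card {w. (v, w) \<in> parcs G}" for v
  proof -
    have "{e \<in> parcs G. fst e = v} = Pair v ` {w. (v, w) \<in> parcs G}" by (auto simp: image_iff)
    then show ?thesis
      by (simp add: out_degree_def out_arcs_def card_image inj_on_def)
  qed
  have degs: "finite (out_degree (with_proj G) ` pverts G)" "out_degree (with_proj G) ` pverts G \<noteq> {}"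
    using pair_finite_verts n_card n_ge by auto
  have deg: "d \<le> card {w. (v, w) \<in> parcs G}" if "v \<in> pverts G" for v
    using Min_le[OF degs(1), of "out_degree (with_proj G) v"] that
    by (simp add: d_def min_degree_def out_degree)
  \<comment> \<open>The Perron estimate is applied at a vertex attaining the minimum degree, where
    the degree is exactly \<open>c * n\<close>.\<close>
  have "d \<in> out_degree (with_proj G) ` pverts G"
    using Min_in[OF degs] by (simp add: d_def min_degree_def)
  then obtain v where v: "v \<in> pverts G" "card {w. (v, w) \<in> parcs G} = d"
    using out_degree by auto
  have "real d \<le> 1 * real n" unfolding d using c by (intro mult_right_mono) auto
  then have dn: "d \<le> n" by simp
  then have nd: "real (n - d) = (1 - c) * real n"
    using d by (simp add: of_nat_diff algebra_simps)
  define y where "y = real n * (min_entry \<nu>)\<^sup>2"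
  have y: "0 \<le> y" "y \<le> 1" and \<mu>2: "\<mu>\<^sup>2 \<le> c * y * (1 - (1 - c) * y)"
    using perron_degree_bound[OF v] unfolding \<mu>_def y_def d nd by (simp_all add: algebra_simps)
  note \<mu>_le = perron_weight_le[OF \<mu>_nonneg \<mu>2 c y]
  \<comment> \<open>The largest \<open>k\<close> for which deleting \<open>4 * (k - 1)\<close>
    vertices from a neighbourhood keeps the mixing condition, since
    \<open>\<mu> * d - lam = g\<close>. The lower bound \<open>g / (4 * \<mu>)\<close> on
    \<open>k\<close> limits the number of batches.\<close>
  define k where "k = nat \<lceil>g / (4 * \<mu>)\<rceil>"
  have "0 < g / (4 * \<mu>)" using g \<mu> by simp
  then have k: "0 < k" "g / (4 * \<mu>) \<le> real k" "real k - 1 < g / (4 * \<mu>)"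
    unfolding k_def by linarith+
  have g_le: "g \<le> 4 * \<mu> * real k"
    using k(2) \<mu> by (simp add: field_simps)
  have "(real k - 1) * (4 * \<mu>) < g"
    using k(3) \<mu> by (simp add: pos_less_divide_eq)
  then have "4 * (real k - 1) * \<mu> < \<mu> * c * real n - lam"
    using \<mu> by (simp add: g_def algebra_simps)
  moreover have r: "real (4 * (k - 1)) = 4 * (real k - 1)"
    using k(1) by (simp add: of_nat_diff)
  ultimately have slack: "lam < \<mu> * (real d - real (4 * (k - 1)))"
    unfolding d by (simp add: algebra_simps)
  \<comment> \<open>As \<open>lam\<close> is nonnegative, the slack also yields
    \<open>4 * (k - 1) \<le> d\<close>, so that the subtraction on \<open>nat\<close> below is not
    truncated.\<close>
  then have "0 < \<mu> * (real d - real (4 * (k - 1)))" using \<open>0 \<le> lam\<close> by linarith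
  then have rd: "4 * (k - 1) \<le> d"
    using \<mu> by (simp add: zero_less_mult_iff)
  have gap': "max \<bar>eigval A 2\<bar> \<bar>eigval A n\<bar> < eigval A 1 * (min_entry \<nu>)\<^sup>2 * real (d - 4 * (k - 1))"
    using slack unfolding of_nat_diff[OF rd] \<mu>_def lam .
  have path: "\<exists>x y. x \<notin> W \<and> y \<notin> W \<and> (u, x) \<in> parcs G \<and> (x, y) \<in> parcs G \<and> (y, v) \<in> parcs G"
    if "u \<in> pverts G" "v \<in> pverts G" "finite W" "card W \<le> 4 * (k - 1)" for u v W
    by (rule short_path[OF deg rd gap' that])
  show ?thesis
    unfolding g_eq
  proof (rule routing_number_le[OF path deg])
    fix m :: nat
    assume "m \<le> card (pverts G)" "m \<le> 4 * (card (pverts G) - d)"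
    then have m: "m \<le> n" "m \<le> 4 * (n - d)" by (simp_all only: n_card)
    then have "real m \<le> real (4 * (n - d))" by (simp only: of_nat_le_iff)
    then have m': "real m \<le> 4 * (1 - c) * real n" using nd by (simp add: algebra_simps)
    \<comment> \<open>Number of batches; rounding up costs less than one extra batch.\<close>
    define t where "t = nat \<lceil>real m / (2 * real k)\<rceil>"
    have t: "real m / (2 * real k) \<le> real t" "real t \<le> real m / (2 * real k) + 1"
    proof -
      have "0 \<le> real m / (2 * real k)" by simp
      then show "real m / (2 * real k) \<le> real t" "real t \<le> real m / (2 * real k) + 1"
        unfolding t_def by linarith+
    qed
    have "real m \<le> real t * (2 * real k)"
      using t(1) k(1) by (simp add: pos_divide_le_eq)
    then have "real m \<le> real (t * (2 * k))" by simp
    then have mt: "m \<le> t * (2 * k)" by (simp only: of_nat_le_iff)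
    have "real m / (2 * real k) \<le> 2 * \<mu> * real m / g"
      using mult_left_mono[OF g_le, of "real m"] k(1) g(1)
      by (simp add: pos_divide_le_eq pos_le_divide_eq algebra_simps)
    then have "2 + 3 * real t \<le> 5 + 6 * \<mu> * real m / g"
      using t(2) by simp
    also have "\<dots> \<le> 6 * real n / (c * g)"
      using c \<mu> \<mu>_le n m m' g by (intro step_count_le) simp_all
    finally have "2 * (2 + 3 * real t) \<le> 12 * real n / (c * g)" by simp
    with mt show "\<exists>t. m \<le> t * (2 * k) \<and> 2 * (2 + 3 * real t) \<le> 12 * real n / (c * g)" by blast
  qed auto
qed

end
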